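(* Let $p$ be a prime, and let $1 \le t \le d < p$ be integers. There exists a positive integer $\gamma(p,d,t)$ such that the following holds for every positive integer $n$. Let $P: \mathbb{F}_p^n \to \mathbb{F}_p$ be a polynomial with degree at most $d$. Assume that the image $P(\mathbb{F}_p^n)$ does not contain the image $A(\mathbb{F}_p)$ of any non-constant polynomial $A:\mathbb{F}_p \to \mathbb{F}_p$ with degree at most $t$. 1. If $t \le d-1$, then $P$ has degree-$\lfloor d/(t+1) \rfloor$ rank at most $\gamma(p,d,t)$. 2. If $t = d$, then $P$ is a constant polynomial.
   Context: Let $\mathbb{F}$ be a field, let $P:\mathbb{F}^n\to\mathbb{F}$ be a polynomial and let $e\ge 1$ be an integer. A polynomial has degree-$e$ rank at most $1$ if it can be written as a product of polynomials each with degree at most $e$. The degree-$e$ rank of $P$, denoted $\mathrm{rk}_e P$, is the smallest nonnegative integer $k$ such that there exist polynomials $P_1,\dots,P_k$, each with degree-$e$ rank at most $1$ and each with degree at most the degree of $P$, satisfying $P=P_1+\dots+P_k$. (The zero polynomial has degree-$e$ rank $0$.) All statements are uniform in $n$: the bound does not depend on $n$. *)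

theory Defs
  imports "HOL-Library.Poly_Mapping" "HOL-Library.FuncSet" "Berlekamp_Zassenhaus.Finite_Field"
begin

text \<open>
  Formal multivariate polynomials with variables indexed by the natural numbers: a monomial is a
  finitely supported exponent function, a polynomial is a finitely supported coefficient function
  on monomials, and multiplication is the convolution provided by \<^theory>\<open>HOL-Library.Poly_Mapping\<close>.
\<close>

type_synonym 'a mpoly = "(nat \<Rightarrow>\<^sub>0 nat) \<Rightarrow>\<^sub>0 'a"

definition polys :: "nat \<Rightarrow> 'a::zero mpoly set"
  where "polys n = {P. \<forall>m \<in> Poly_Mapping.keys P. Poly_Mapping.keys m \<subseteq> {..<n}}"

definition monom_degree :: "(nat \<Rightarrow>\<^sub>0 nat) \<Rightarrow> nat"
  where "monom_degree m = (\<Sum>i\<in>Poly_Mapping.keys m. Poly_Mapping.lookup m i)"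

text \<open>The inserted \<open>0\<close> only matters for the zero polynomial, which gets degree \<open>0\<close>.\<close>

definition total_degree :: "'a::zero mpoly \<Rightarrow> nat"
  where "total_degree P = Max (insert 0 (monom_degree ` Poly_Mapping.keys P))"

definition mconst :: "'a::zero \<Rightarrow> 'a mpoly"
  where "mconst c = Poly_Mapping.single 0 c"

definition meval :: "'a::comm_semiring_1 mpoly \<Rightarrow> (nat \<Rightarrow> 'a) \<Rightarrow> 'a"
  where "meval P x = (\<Sum>m\<in>Poly_Mapping.keys P.
    Poly_Mapping.lookup P m * (\<Prod>i\<in>Poly_Mapping.keys m. x i ^ Poly_Mapping.lookup m i))"

text \<open>The points of \<open>F\<^sup>n\<close> are the functions on \<open>{..<n}\<close>, extended by \<open>undefined\<close>.\<close>

definition mimage :: "nat \<Rightarrow> 'a::comm_semiring_1 mpoly \<Rightarrow> 'a set"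
  where "mimage n P = meval P ` ({..<n} \<rightarrow>\<^sub>E UNIV)"

definition rank_at_most_one :: "nat \<Rightarrow> nat \<Rightarrow> 'a::field mpoly \<Rightarrow> bool"
  where "rank_at_most_one n e P \<longleftrightarrow>
    (\<exists>Qs. (\<forall>Q \<in> set Qs. Q \<in> polys n \<and> total_degree Q \<le> e) \<and> P = prod_list Qs)"

definition has_decomposition :: "nat \<Rightarrow> nat \<Rightarrow> 'a::field mpoly \<Rightarrow> nat \<Rightarrow> bool"
  where "has_decomposition n e P k \<longleftrightarrow>
    (\<exists>Ps. length Ps = k \<and>
      (\<forall>R \<in> set Ps. rank_at_most_one n e R \<and> total_degree R \<le> total_degree P) \<and>
      P = sum_list Ps)"

text \<open>
  The degree-\<open>e\<close> rank of a polynomial \<open>P\<close> in \<open>n\<close> variables. It is meaningful for \<open>e \<ge> 1\<close>: then a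
  decomposition exists, so that the minimum is attained (lemma \<open>deg_rank_attained\<close> below).
\<close>

definition deg_rank :: "nat \<Rightarrow> nat \<Rightarrow> 'a::field mpoly \<Rightarrow> nat"
  where "deg_rank n e P = (LEAST k. has_decomposition n e P k)"

lemma monom_degree_superset:
  assumes "finite A" "Poly_Mapping.keys m \<subseteq> A"
  shows "monom_degree m = (\<Sum>i\<in>A. Poly_Mapping.lookup m i)"
  unfolding monom_degree_def
  using assms by (intro sum.mono_neutral_left) (auto simp: in_keys_iff)

lemma monom_degree_add: "monom_degree (m + m') = monom_degree m + monom_degree m'"
  using monom_degree_superset[of "Poly_Mapping.keys m \<union> Poly_Mapping.keys m'" "m + m'"]
    monom_degree_superset[of "Poly_Mapping.keys m \<union> Poly_Mapping.keys m'" m]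
    monom_degree_superset[of "Poly_Mapping.keys m \<union> Poly_Mapping.keys m'" m'] Poly_Mapping.keys_add[of m m']
  by (simp add: lookup_add sum.distrib)

lemma total_degree_single:
  "total_degree (Poly_Mapping.single m c) = (if c = 0 then 0 else monom_degree m)"
  by (simp add: total_degree_def)

lemma rank_at_most_one_single:
  fixes c :: "'a::field"
  assumes "e \<ge> 1"
  shows "Poly_Mapping.keys m \<subseteq> {..<n} \<Longrightarrow> rank_at_most_one n e (Poly_Mapping.single m c)"
proof (induction "monom_degree m" arbitrary: m)
  case 0
  then have "m = 0"
    by (intro poly_mapping_eqI) (auto simp: monom_degree_def in_keys_iff)
  then show ?case
    unfolding rank_at_most_one_def
    by (intro exI[of _ "[Poly_Mapping.single 0 c]"])
      (auto simp: polys_def total_degree_single monom_degree_def)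
next
  case (Suc k)
  then obtain i where i: "i \<in> Poly_Mapping.keys m" unfolding monom_degree_def by fastforce
  define v :: "nat \<Rightarrow>\<^sub>0 nat" where "v = Poly_Mapping.single i 1"
  have deg_v: "monom_degree v = 1" by (simp add: v_def monom_degree_def)
  have m: "m = v + (m - v)"
    using i by (intro poly_mapping_eqI)
      (auto simp: v_def lookup_add lookup_minus lookup_single in_keys_iff when_def)
  have "monom_degree m = Suc (monom_degree (m - v))"
    using m deg_v by (metis monom_degree_add plus_1_eq_Suc)
  moreover have "Poly_Mapping.keys (m - v) \<subseteq> {..<n}"
    using Suc.prems by (auto simp: in_keys_iff lookup_minus subset_iff)
  ultimately obtain Qs where Qs: "\<forall>Q \<in> set Qs. Q \<in> polys n \<and> total_degree Q \<le> e"
    "Poly_Mapping.single (m - v) c = prod_list Qs"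
    using Suc.hyps unfolding rank_at_most_one_def by fastforce
  have "Poly_Mapping.single m c = Poly_Mapping.single v 1 * Poly_Mapping.single (m - v) c"
    by (subst m) (simp add: mult_single)
  moreover have "Poly_Mapping.single v (1::'a) \<in> polys n"
    using i Suc.prems by (auto simp: polys_def v_def)
  ultimately show ?case
    unfolding rank_at_most_one_def using Qs deg_v assms
    by (intro exI[of _ "Poly_Mapping.single v 1 # Qs"]) (auto simp: total_degree_single)
qed

lemma deg_rank_attained:
  fixes P :: "'a::field mpoly"
  assumes "e \<ge> 1" "P \<in> polys n"
  shows "has_decomposition n e P (deg_rank n e P)"
proof -
  obtain ms where ms: "set ms = Poly_Mapping.keys P" "distinct ms"
    using finite_distinct_list[of "Poly_Mapping.keys P"] by auto
  define Ps where "Ps = map (\<lambda>m. Poly_Mapping.single m (Poly_Mapping.lookup P m)) ms"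
  have "P = (\<Sum>m\<in>Poly_Mapping.keys P. Poly_Mapping.single m (Poly_Mapping.lookup P m))"
    by (intro poly_mapping_eqI)
      (auto simp: lookup_sum lookup_single when_def in_keys_iff)
  then have "P = sum_list Ps"
    unfolding Ps_def using ms by (simp add: sum_list_distinct_conv_sum_set)
  moreover have "rank_at_most_one n e R \<and> total_degree R \<le> total_degree P"
    if R_in: "R \<in> set Ps" for R
  proof -
    obtain m where m: "m \<in> Poly_Mapping.keys P"
      and R: "R = Poly_Mapping.single m (Poly_Mapping.lookup P m)"
      using R_in ms by (auto simp: Ps_def)
    have "rank_at_most_one n e R"
      unfolding R using assms m by (intro rank_at_most_one_single) (auto simp: polys_def)
    moreover have "total_degree R \<le> total_degree P"
      unfolding R total_degree_single using m by (simp add: total_degree_def)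
    ultimately show ?thesis ..
  qed
  ultimately have "has_decomposition n e P (length Ps)"
    unfolding has_decomposition_def by blast
  then show ?thesis unfolding deg_rank_def by (rule LeastI)
qed

lemma deg_rank_zero: "deg_rank n e 0 = 0"
  unfolding deg_rank_def has_decomposition_def by (rule Least_eq_0) simp

end

theory Submission
  imports Defs
begin

text \<open>
  Throughout, \<open>F\<close> is the field with \<open>p\<close> elements and all degrees are smaller than \<open>p\<close>, so that
  polynomials and polynomial functions are the same thing. The proof works with functions and
  returns to formal polynomials only at the end.
  
  Call \<open>f\<close> decomposable for \<open>g\<close> if it is a sum of boundedly many products of polynomials of degree at
  most \<open>g\<close>, and determined for \<open>g\<close> if for every point \<open>w\<close> there are boundedly many polynomials of
  degree at most \<open>g\<close> such that \<open>f\<close> is constant on the set of points at which all of them take the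
  same values as at \<open>w\<close>. Every bound below depends on \<open>p\<close>, the degrees and previous bounds, never
  on the number \<open>n\<close> of variables. A polynomial of degree at most \<open>d\<close> is decomposable for \<open>d\<close>, and two
  facts together lower \<open>g\<close> by one as long as \<open>g (t + 1) > d\<close>, that is, until \<open>g = d div (t + 1)\<close>
  is reached.
  
  First (\<open>avoids_imp_determined\<close>), if \<open>P\<close> is decomposable for \<open>g\<close> and its image contains no
  \<open>A(F)\<close> with \<open>A\<close> non-constant of degree at most \<open>t\<close>, then \<open>P\<close> is determined for \<open>g - 1\<close>. Consider steps
  \<open>z\<close> along which the parts of degree \<open>1, ..., g - 1\<close> of all factors vanish. Such a step changes each
  factor \<open>a\<close> by the value \<open>v a\<close> of its part of degree \<open>g\<close>, which does not depend on the point from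
  which the step is made. If steps with the same \<open>v\<close> can be repeated for ever from \<open>w\<close>, then \<open>P\<close>
  takes the value \<open>A(i)\<close> after \<open>i\<close> steps, where \<open>A(y)\<close> arises from the decomposition by replacing
  each factor \<open>a\<close> with \<open>a w + y v a\<close>. Only factors of degree exactly \<open>g\<close> contribute to the degree of \<open>A\<close>,
  and a product of degree at most \<open>d\<close> has at most \<open>t\<close> of them. So \<open>A\<close> has degree at most \<open>t\<close>, it
  is constant by hypothesis, and a step does not change \<open>P\<close>. If the steps get stuck for some
  \<open>v\<close>, then the low-degree parts at one point where they are stuck exclude all steps with this \<open>v\<close>.
  
  Second (\<open>determined_imp_decomposable\<close>), a polynomial that is determined for \<open>g\<close> is decomposable for
  \<open>g\<close>. Suppose that \<open>Q\<close> vanishes on a common level set of polynomials of degree at most \<open>g\<close>, and let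
  \<open>\<beta>\<close> be one of them of the largest degree \<open>h\<close>. Either \<open>\<beta>\<close> is constant on a common level set of the
  others and of boundedly many polynomials of lower degree, so that \<open>\<beta>\<close> can be dropped, or there
  are vectors \<open>k\<^sub>1, ..., k\<^sub>h\<close> such that passing from \<open>x\<close> to \<open>x + c\<^sub>1 k\<^sub>1 + ... + c\<^sub>h k\<^sub>h\<close> adds
  \<open>c\<^sub>1 \<cdots> c\<^sub>h\<close> to \<open>\<beta>\<close> and does not change the others (\<open>constant_or_product_system\<close>,
  \<open>elimination_step\<close>). In the latter case \<open>Q\<close> vanishes at these points whenever \<open>c\<^sub>1 \<cdots> c\<^sub>h\<close> cancels the
  value \<open>s\<close> of \<open>\<beta>\<close>, and summing over all such \<open>c\<close> expresses \<open>Q\<close> as \<open>\<Sum>\<^sub>i s\<^sup>i Y\<^sub>i\<close> with \<open>i \<ge> 1\<close>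
  and \<open>deg Y\<^sub>i \<le> deg Q - h i\<close> (\<open>division\<close>). The \<open>Y\<^sub>i\<close> are combinations of translates of \<open>Q\<close>, hence again
  determined, and decomposable by induction on the degree. Subtracting the sum from \<open>Q\<close> leaves a
  polynomial that vanishes on a level set of a family with one polynomial of degree \<open>h\<close> fewer.
\<close>

section \<open>Power sums over a prime field\<close>

type_synonym 'p point = "nat \<Rightarrow> 'p mod_ring"

lemma power_card_minus_one:
  fixes c :: "'p::prime_card mod_ring"
  assumes "c \<noteq> 0"
  shows "c ^ (CARD('p) - 1) = 1"
proof -
  have "c * c ^ (CARD('p) - 1) = c"
    using finite_field_power_card_eq_same[of c] prime_gt_0_nat[OF prime_card[where 'a='p]]
    by (metis CARD_mod_ring Suc_diff_1 power_Suc)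
  then show ?thesis using assms by simp
qed

lemma prime_card_gt_1: "CARD('p::prime_card) > 1"
  using prime_gt_1_nat[OF prime_card[where 'a='p]] .

lemma sum_power_low:
  assumes "0 < m" "m < CARD('p::prime_card) - 1"
  shows "(\<Sum>c\<in>UNIV. (c :: 'p mod_ring) ^ m) = 0"
proof -
  define q where "q = (monom 1 m - 1 :: 'p mod_ring poly)"
  have "q \<noteq> 0"
    using assms(1) by (auto simp: q_def poly_eq_iff dest!: spec[of _ m])
  have "degree q \<le> m"
    unfolding q_def by (intro degree_diff_le degree_monom_le) simp
  have "card {c. poly q c = 0} \<le> m"
    using card_poly_roots_bound[OF \<open>q \<noteq> 0\<close>] \<open>degree q \<le> m\<close> by linarith
  also have "m < card (UNIV - {0 :: 'p mod_ring})"
    using assms by (simp add: card_Diff_singleton)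
  finally have "\<not> UNIV - {0} \<subseteq> {c. poly q c = 0}"
    using card_mono[of "{c. poly q c = 0}" "UNIV - {0}"] by fastforce
  then obtain a :: "'p mod_ring" where a: "a \<noteq> 0" "a ^ m \<noteq> 1"
    by (auto simp: q_def poly_monom)
  have "(\<Sum>c\<in>UNIV. c ^ m) = (\<Sum>c\<in>UNIV. (a * c) ^ m)"
    using a by (intro sum.reindex_bij_witness[of _ "\<lambda>c. a * c" "\<lambda>c. c / a"]) auto
  also have "\<dots> = a ^ m * (\<Sum>c\<in>UNIV. c ^ m)"
    by (simp add: power_mult_distrib sum_distrib_left)
  finally show ?thesis using a by (metis mult_cancel_right1)
qed

lemma sum_power_top: "(\<Sum>c\<in>UNIV. (c :: 'p::prime_card mod_ring) ^ (CARD('p) - 1)) = -1"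
proof -
  have "(\<Sum>c\<in>UNIV. (c :: 'p mod_ring) ^ (CARD('p) - 1)) = (\<Sum>c\<in>UNIV - {0 :: 'p mod_ring}. 1)"
    using prime_card_gt_1[where 'p='p] power_card_minus_one[where 'p='p]
    by (intro sum.mono_neutral_cong_right) (simp_all add: zero_power)
  also have "\<dots> = of_nat (CARD('p) - 1)"
    by (simp add: card_Diff_singleton)
  finally show ?thesis
    using prime_card_gt_1[where 'p='p] by (simp add: of_nat_diff)
qed

lemma sum_power_shifted:
  fixes i j :: nat
  assumes "1 \<le> j" "j \<le> CARD('p::prime_card) - 1" "i \<le> CARD('p) - 1"
  shows "(\<Sum>c\<in>UNIV. (c :: 'p mod_ring) ^ (CARD('p) - 1 - j) * c ^ i) = (if i = j then -1 else 0)"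
proof -
  let ?p = "CARD('p)"
  have eq: "(\<Sum>c\<in>UNIV. (c :: 'p mod_ring) ^ (?p - 1 - j) * c ^ i) = (\<Sum>c\<in>UNIV. c ^ (?p - 1 - j + i))"
    by (simp add: power_add)
  consider "i = j" | "i < j" | "i > j" by linarith
  then show ?thesis
  proof cases
    case 1
    then show ?thesis using eq sum_power_top[where 'p='p] assms by simp
  next
    case 2
    show ?thesis
    proof (cases "?p - 1 - j + i = 0")
      case True
      then show ?thesis using eq 2 by simp
    next
      case False
      then have "0 < ?p - 1 - j + i" "?p - 1 - j + i < ?p - 1" using 2 assms by auto
      then show ?thesis using eq sum_power_low[where 'p='p] 2 by simp
    qed
  next
    case 3
    have red: "c ^ (?p - 1 - j + i) = c ^ (i - j)" for c :: "'p mod_ring"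
    proof (cases "c = 0")
      case True
      then show ?thesis using 3 assms by (simp add: zero_power)
    next
      case False
      have "?p - 1 - j + i = (?p - 1) + (i - j)" using 3 assms by simp
      then show ?thesis using power_card_minus_one[OF False] by (metis mult_1 power_add)
    qed
    have "0 < i - j" "i - j < ?p - 1" using 3 assms by auto
    then show ?thesis using eq red sum_power_low[where 'p='p] 3 by simp
  qed
qed

lemma coeff_by_power_sum:
  fixes F :: "'p::prime_card mod_ring poly"
  assumes "1 \<le> j" "j \<le> CARD('p) - 1" "degree F \<le> CARD('p) - 1"
  shows "(\<Sum>c\<in>UNIV. c ^ (CARD('p) - 1 - j) * poly F c) = - coeff F j"
proof -
  let ?p = "CARD('p)"
  have "(\<Sum>c\<in>UNIV. c ^ (?p - 1 - j) * poly F c)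
      = (\<Sum>i\<le>degree F. coeff F i * (\<Sum>c\<in>UNIV. c ^ (?p - 1 - j) * c ^ i))"
    unfolding poly_altdef sum_distrib_left by (subst sum.swap) (simp add: algebra_simps)
  also have "\<dots> = (\<Sum>i\<le>degree F. if i = j then - coeff F j else 0)"
    using assms by (intro sum.cong refl) (subst sum_power_shifted, auto)
  also have "\<dots> = - coeff F j"
    by (simp add: coeff_eq_0)
  finally show ?thesis .
qed

section \<open>Polynomial functions and their homogeneous parts\<close>

text \<open>
  The second argument is an upper bound for the degree. An inductive definition by the ring
  operations turns closure properties into rule inductions; \<open>poly_fun_iff_meval\<close> identifies these
  functions with the evaluations of formal polynomials.
\<close>

inductive poly_fun :: "nat \<Rightarrow> nat \<Rightarrow> ((nat \<Rightarrow> 'a::comm_ring_1) \<Rightarrow> 'a) \<Rightarrow> bool" for n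
  where
    const: "poly_fun n d (\<lambda>_. c)"
  | coord: "i < n \<Longrightarrow> poly_fun n (Suc d) (\<lambda>x. x i)"
  | add: "poly_fun n d f \<Longrightarrow> poly_fun n d g \<Longrightarrow> poly_fun n d (\<lambda>x. f x + g x)"
  | mult: "poly_fun n d f \<Longrightarrow> poly_fun n e g \<Longrightarrow> poly_fun n (d + e) (\<lambda>x. f x * g x)"

lemma poly_fun_mono:
  assumes "poly_fun n d f" "d \<le> e"
  shows "poly_fun n e f"
  using assms
proof (induction arbitrary: e)
  case (coord i d)
  then show ?case using poly_fun.coord[of i n "e - 1"] by simp
next
  case (mult d1 f d2 g)
  then have "poly_fun n (e - d2) f" "poly_fun n d2 g" by auto
  then show ?case using poly_fun.mult[of n "e - d2" f d2 g] mult.prems by simp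
qed (auto intro: poly_fun.intros)

lemma poly_fun_cmult: "poly_fun n d f \<Longrightarrow> poly_fun n d (\<lambda>x. c * f x)"
  using poly_fun.mult[OF poly_fun.const[of n 0 c]] by simp

lemma poly_fun_uminus: "poly_fun n d f \<Longrightarrow> poly_fun n d (\<lambda>x. - f x)"
  using poly_fun_cmult[of n d f "-1"] by simp

lemma poly_fun_diff: "poly_fun n d f \<Longrightarrow> poly_fun n d g \<Longrightarrow> poly_fun n d (\<lambda>x. f x - g x)"
  using poly_fun.add[OF _ poly_fun_uminus] by fastforce

lemma poly_fun_sum: "(\<And>i. i \<in> I \<Longrightarrow> poly_fun n d (f i)) \<Longrightarrow> poly_fun n d (\<lambda>x. \<Sum>i\<in>I. f i x)"
  by (induction I rule: infinite_finite_induct) (auto intro: poly_fun.intros)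

lemma poly_fun_power: "poly_fun n d f \<Longrightarrow> poly_fun n (m * d) (\<lambda>x. f x ^ m)"
  by (induction m) (auto intro: poly_fun.intros)

lemma poly_fun_degree_0: "poly_fun n 0 f \<Longrightarrow> f x = f y"
proof -
  have "poly_fun n d f \<Longrightarrow> d = 0 \<Longrightarrow> f x = f y" for d
    by (induction rule: poly_fun.induct) auto
  then show "poly_fun n 0 f \<Longrightarrow> f x = f y" by simp
qed

definition shift :: "(nat \<Rightarrow> 'a::comm_ring_1) \<Rightarrow> 'a \<Rightarrow> (nat \<Rightarrow> 'a) \<Rightarrow> nat \<Rightarrow> 'a"
  where "shift x c k = (\<lambda>i. x i + c * k i)"

lemma shift_0 [simp]: "shift x 0 k = x"
  by (simp add: shift_def)

lemma shift_zero_vec [simp]: "shift x c (\<lambda>_. 0) = x"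
  by (simp add: shift_def)

lemma shift_of_zero_1 [simp]: "shift (\<lambda>_. 0) 1 x = x"
  by (simp add: shift_def)

text \<open>
  Expanding \<open>f (x + c k)\<close> in powers of \<open>c\<close>, the coefficient of \<open>c ^ j\<close> has degree at most \<open>j\<close> in \<open>k\<close> and
  at most \<open>d - j\<close> in \<open>x\<close>.
\<close>

lemma poly_fun_along_line:
  fixes f :: "(nat \<Rightarrow> 'a::idom) \<Rightarrow> 'a"
  assumes "poly_fun n d f"
  shows "\<exists>\<Phi>. (\<forall>x k c. f (shift x c k) = poly (\<Phi> x k) c) \<and> (\<forall>x k. degree (\<Phi> x k) \<le> d) \<and>
    (\<forall>j k. j \<le> d \<longrightarrow> poly_fun n (d - j) (\<lambda>x. coeff (\<Phi> x k) j)) \<and>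
    (\<forall>j x. j \<le> d \<longrightarrow> poly_fun n j (\<lambda>k. coeff (\<Phi> x k) j))"
  using assms
proof induction
  case (const d c)
  show ?case
    by (intro exI[of _ "\<lambda>_ _. [:c:]"]) (auto intro: poly_fun.const)
next
  case (coord i d)
  have c: "coeff [:a, b:] j = (if j = 0 then a else if j = 1 then b else 0)" for a b :: 'a and j
    by (auto simp: coeff_pCons split: nat.split)
  have i: "poly_fun n (Suc e) (\<lambda>x. x i)" for e :: nat
    by (rule poly_fun.coord[OF coord])
  have "poly_fun n (Suc d - j) (\<lambda>x. coeff [:x i, k i:] j)"
    "poly_fun n j (\<lambda>k. coeff [:x i, k i:] j)" for j and k x :: "nat \<Rightarrow> 'a"
  proof -
    consider "j = 0" | "j = 1" | "j \<noteq> 0" "j \<noteq> 1" by blast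
    then show "poly_fun n (Suc d - j) (\<lambda>x. coeff [:x i, k i:] j)"
      "poly_fun n j (\<lambda>k. coeff [:x i, k i:] j)"
      unfolding c by (cases; simp add: poly_fun.const i i[of 0, simplified])+
  qed
  then show ?case
    by (intro exI[of _ "\<lambda>x k. [:x i, k i:]"]) (auto simp: shift_def)
next
  case (add d f g)
  then obtain F G where
    F: "\<And>x k c. f (shift x c k) = poly (F x k) c" "\<And>x k. degree (F x k) \<le> d"
      "\<And>j k. j \<le> d \<Longrightarrow> poly_fun n (d - j) (\<lambda>x. coeff (F x k) j)"
      "\<And>j x. j \<le> d \<Longrightarrow> poly_fun n j (\<lambda>k. coeff (F x k) j)"
    and G: "\<And>x k c. g (shift x c k) = poly (G x k) c" "\<And>x k. degree (G x k) \<le> d"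
      "\<And>j k. j \<le> d \<Longrightarrow> poly_fun n (d - j) (\<lambda>x. coeff (G x k) j)"
      "\<And>j x. j \<le> d \<Longrightarrow> poly_fun n j (\<lambda>k. coeff (G x k) j)"
    by metis
  show ?case
    by (intro exI[of _ "\<lambda>x k. F x k + G x k"])
      (auto simp: F(1) G(1) intro: degree_add_le F G poly_fun.add)
next
  case (mult d f e g)
  then obtain F G where
    F: "\<And>x k c. f (shift x c k) = poly (F x k) c" "\<And>x k. degree (F x k) \<le> d"
      "\<And>j k. j \<le> d \<Longrightarrow> poly_fun n (d - j) (\<lambda>x. coeff (F x k) j)"
      "\<And>j x. j \<le> d \<Longrightarrow> poly_fun n j (\<lambda>k. coeff (F x k) j)"
    and G: "\<And>x k c. g (shift x c k) = poly (G x k) c" "\<And>x k. degree (G x k) \<le> e"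
      "\<And>j k. j \<le> e \<Longrightarrow> poly_fun n (e - j) (\<lambda>x. coeff (G x k) j)"
      "\<And>j x. j \<le> e \<Longrightarrow> poly_fun n j (\<lambda>k. coeff (G x k) j)"
    by metis
  have "poly_fun n (d + e - j) (\<lambda>x. coeff (F x k * G x k) j)" if "j \<le> d + e" for j k
    unfolding coeff_mult
  proof (rule poly_fun_sum)
    fix i assume "i \<in> {..j}"
    show "poly_fun n (d + e - j) (\<lambda>x. coeff (F x k) i * coeff (G x k) (j - i))"
    proof (cases "i \<le> d \<and> j - i \<le> e")
      case True
      then have "poly_fun n ((d - i) + (e - (j - i))) (\<lambda>x. coeff (F x k) i * coeff (G x k) (j - i))"
        by (intro poly_fun.mult F G) auto
      then show ?thesis by (rule poly_fun_mono) (use \<open>i \<in> {..j}\<close> True in auto)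
    next
      case False
      then have "degree (F x k) < i \<or> degree (G x k) < j - i" for x
        using F(2)[of x k] G(2)[of x k] by linarith
      then have "(\<lambda>x. coeff (F x k) i * coeff (G x k) (j - i)) = (\<lambda>_. 0)"
        by (metis (no_types) coeff_eq_0 mult_zero_left mult_zero_right)
      then show ?thesis by (simp add: poly_fun.const)
    qed
  qed
  moreover have "poly_fun n j (\<lambda>k. coeff (F x k * G x k) j)" if "j \<le> d + e" for j x
    unfolding coeff_mult
  proof (rule poly_fun_sum)
    fix i assume "i \<in> {..j}"
    show "poly_fun n j (\<lambda>k. coeff (F x k) i * coeff (G x k) (j - i))"
    proof (cases "i \<le> d \<and> j - i \<le> e")
      case True
      then have "poly_fun n (i + (j - i)) (\<lambda>k. coeff (F x k) i * coeff (G x k) (j - i))"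
        by (intro poly_fun.mult F G) auto
      then show ?thesis using \<open>i \<in> {..j}\<close> by simp
    next
      case False
      then have "degree (F x k) < i \<or> degree (G x k) < j - i" for k
        using F(2)[of x k] G(2)[of x k] by linarith
      then have "(\<lambda>k. coeff (F x k) i * coeff (G x k) (j - i)) = (\<lambda>_. 0)"
        by (metis (no_types) coeff_eq_0 mult_zero_left mult_zero_right)
      then show ?thesis by (simp add: poly_fun.const)
    qed
  qed
  moreover have "degree (F x k * G x k) \<le> d + e" for x k
    using degree_mult_le[of "F x k" "G x k"] F(2)[of x k] G(2)[of x k] by linarith
  ultimately show ?case
    by (intro exI[of _ "\<lambda>x k. F x k * G x k"]) (auto simp: F(1) G(1))
qed

text \<open>
  The part of degree \<open>j\<close> in \<open>k\<close> of \<open>f (x + k)\<close>, for \<open>1 \<le> j < p\<close> and \<open>f\<close> of degree less than \<open>p\<close>: the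
  power sum extracts the coefficient of \<open>c ^ j\<close> from \<open>f (x + c k)\<close>. The explicit formula shows that a homogeneous part is a linear
  combination of translates of \<open>f\<close>.
\<close>

definition hom_part :: "nat \<Rightarrow> ('p::prime_card point \<Rightarrow> 'p mod_ring) \<Rightarrow> 'p point \<Rightarrow> 'p point \<Rightarrow> 'p mod_ring"
  where "hom_part j f x k = - (\<Sum>c\<in>UNIV. c ^ (CARD('p) - 1 - j) * f (shift x c k))"

lemma hom_part_eq_coeff:
  fixes f :: "'p::prime_card point \<Rightarrow> 'p mod_ring"
  assumes "poly_fun n d f" "d < CARD('p)"
  obtains \<Phi> where "\<And>x k c. f (shift x c k) = poly (\<Phi> x k) c" "\<And>x k. degree (\<Phi> x k) \<le> d"
    "\<And>j k. j \<le> d \<Longrightarrow> poly_fun n (d - j) (\<lambda>x. coeff (\<Phi> x k) j)"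
    "\<And>j x. j \<le> d \<Longrightarrow> poly_fun n j (\<lambda>k. coeff (\<Phi> x k) j)"
    "\<And>j x k. 1 \<le> j \<Longrightarrow> j < CARD('p) \<Longrightarrow> hom_part j f x k = coeff (\<Phi> x k) j"
proof -
  obtain \<Phi> where \<Phi>: "\<And>x k c. f (shift x c k) = poly (\<Phi> x k) c" "\<And>x k. degree (\<Phi> x k) \<le> d"
    "\<And>j k. j \<le> d \<Longrightarrow> poly_fun n (d - j) (\<lambda>x. coeff (\<Phi> x k) j)"
    "\<And>j x. j \<le> d \<Longrightarrow> poly_fun n j (\<lambda>k. coeff (\<Phi> x k) j)"
    using poly_fun_along_line[OF assms(1)] by metis
  have "hom_part j f x k = coeff (\<Phi> x k) j" if "1 \<le> j" "j < CARD('p)" for j x k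
    unfolding hom_part_def \<Phi>(1)
    using that assms(2) \<Phi>(2)[of x k] by (subst coeff_by_power_sum) auto
  then show ?thesis using that \<Phi> by blast
qed

lemma poly_fun_expand:
  fixes f :: "'p::prime_card point \<Rightarrow> 'p mod_ring"
  assumes "poly_fun n d f" "d < CARD('p)"
  shows "f (shift x c k) = f x + (\<Sum>j=1..d. c ^ j * hom_part j f x k)"
proof -
  obtain \<Phi> where \<Phi>: "\<And>x k c. f (shift x c k) = poly (\<Phi> x k) c" "\<And>x k. degree (\<Phi> x k) \<le> d"
    "\<And>j x k. 1 \<le> j \<Longrightarrow> j < CARD('p) \<Longrightarrow> hom_part j f x k = coeff (\<Phi> x k) j"
    using hom_part_eq_coeff[OF assms] by metis
  have "f x = coeff (\<Phi> x k) 0"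
    using \<Phi>(1)[of x 0 k] by (simp add: poly_0_coeff_0)
  have "f (shift x c k) = (\<Sum>j\<le>d. coeff (\<Phi> x k) j * c ^ j)"
    unfolding \<Phi>(1) using poly_as_sum_of_monoms'[OF \<Phi>(2)[of x k]]
    by (metis (no_types, lifting) poly_monom poly_sum sum.cong)
  also have "\<dots> = coeff (\<Phi> x k) 0 + (\<Sum>j=1..d. coeff (\<Phi> x k) j * c ^ j)"
    by (simp add: sum.atMost_shift atMost_atLeast0 sum.atLeast_Suc_atMost)
  also have "(\<Sum>j=1..d. coeff (\<Phi> x k) j * c ^ j) = (\<Sum>j=1..d. c ^ j * hom_part j f x k)"
    using assms(2) by (intro sum.cong) (auto simp: \<Phi>(3) mult.commute)
  finally show ?thesis using \<open>f x = _\<close> by simp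
qed

lemma poly_fun_hom_part_direction:
  fixes f :: "'p::prime_card point \<Rightarrow> 'p mod_ring"
  assumes "poly_fun n d f" "d < CARD('p)" "1 \<le> j" "j < CARD('p)"
  shows "poly_fun n j (hom_part j f x)"
proof -
  obtain \<Phi> where \<Phi>: "\<And>x k. degree (\<Phi> x k) \<le> d"
    "\<And>j x. j \<le> d \<Longrightarrow> poly_fun n j (\<lambda>k. coeff (\<Phi> x k) j)"
    "\<And>j x k. 1 \<le> j \<Longrightarrow> j < CARD('p) \<Longrightarrow> hom_part j f x k = coeff (\<Phi> x k) j"
    using hom_part_eq_coeff[OF assms(1,2)] by metis
  have eq: "hom_part j f x = (\<lambda>k. coeff (\<Phi> x k) j)" using \<Phi>(3) assms by blast
  show ?thesis
  proof (cases "j \<le> d")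
    case False
    then have "degree (\<Phi> x k) < j" for k using \<Phi>(1)[of x k] by linarith
    then have "(\<lambda>k. coeff (\<Phi> x k) j) = (\<lambda>_. 0)" by (auto intro!: ext coeff_eq_0)
    then show ?thesis unfolding eq by (simp add: poly_fun.const)
  qed (simp add: eq \<Phi>(2))
qed

lemma hom_part_beyond_degree:
  fixes f :: "'p::prime_card point \<Rightarrow> 'p mod_ring"
  assumes "poly_fun n d f" "d < j" "j < CARD('p)"
  shows "hom_part j f x k = 0"
proof -
  obtain \<Phi> where \<Phi>: "\<And>x k. degree (\<Phi> x k) \<le> d"
    "\<And>j x k. 1 \<le> j \<Longrightarrow> j < CARD('p) \<Longrightarrow> hom_part j f x k = coeff (\<Phi> x k) j"
    using hom_part_eq_coeff[of n d f] assms by (metis less_trans)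
  moreover have "degree (\<Phi> x k) < j" using \<Phi>(1)[of x k] assms(2) by linarith
  ultimately show ?thesis using assms by (simp add: coeff_eq_0)
qed

lemma poly_fun_hom_part_base:
  fixes f :: "'p::prime_card point \<Rightarrow> 'p mod_ring"
  assumes "poly_fun n d f" "d < CARD('p)" "1 \<le> j" "j \<le> d"
  shows "poly_fun n (d - j) (\<lambda>x. hom_part j f x k)"
proof -
  obtain \<Phi> where \<Phi>: "\<And>j k. j \<le> d \<Longrightarrow> poly_fun n (d - j) (\<lambda>x. coeff (\<Phi> x k) j)"
    "\<And>j x k. 1 \<le> j \<Longrightarrow> j < CARD('p) \<Longrightarrow> hom_part j f x k = coeff (\<Phi> x k) j"
    using hom_part_eq_coeff[OF assms(1,2)] by metis
  then show ?thesis using assms by simp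
qed

text \<open>
  As a function of the base point, the part of degree \<open>h\<close> has degree \<open>h - h = 0\<close>.
\<close>

lemma hom_part_top_indep:
  fixes f :: "'p::prime_card point \<Rightarrow> 'p mod_ring"
  assumes "poly_fun n h f" "h < CARD('p)" "1 \<le> h"
  shows "hom_part h f x k = hom_part h f y k"
  using poly_fun_degree_0[of n "\<lambda>x. hom_part h f x k" x y] poly_fun_hom_part_base[OF assms(1,2,3) order_refl] by simp

lemma hom_part_zero_direction:
  assumes "1 \<le> j" "j < CARD('p::prime_card)"
  shows "hom_part j (f :: 'p point \<Rightarrow> 'p mod_ring) x (\<lambda>_. 0) = 0"
proof -
  have "(\<Sum>c\<in>UNIV. (c::'p mod_ring) ^ (CARD('p) - 1 - j) * c ^ 0) = 0"
    using sum_power_shifted[of j 0, where 'p='p] assms by simp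
  then show ?thesis
    by (simp add: hom_part_def flip: sum_distrib_right)
qed

lemma poly_fun_expand_top:
  fixes b :: "'p::prime_card point \<Rightarrow> 'p mod_ring"
  assumes "poly_fun n h b" "h < CARD('p)" "1 \<le> h" "\<And>j. 1 \<le> j \<Longrightarrow> j < h \<Longrightarrow> hom_part j b y x = 0"
  shows "b (shift y c x) = b y + c ^ h * hom_part h b y x"
proof -
  have "(\<Sum>j=1..h. c ^ j * hom_part j b y x) = (\<Sum>j\<in>{h}. c ^ j * hom_part j b y x)"
    using assms(3,4) by (intro sum.mono_neutral_right) (auto simp: le_less)
  then show ?thesis using poly_fun_expand[OF assms(1,2)] by simp
qed

text \<open>
  If the parts of degree \<open>1, ..., h - 1\<close> vanish in the direction \<open>x\<close>, only the top part remains; it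
  is the same at every base point, so the increment at \<open>y\<close> can be read off from the one at \<open>w\<close>.
\<close>

lemma additive_of_lower_hom_parts_zero:
  fixes b :: "'p::prime_card point \<Rightarrow> 'p mod_ring"
  assumes "poly_fun n h b" "h < CARD('p)" "1 \<le> h"
    "\<And>j. 1 \<le> j \<Longrightarrow> j < h \<Longrightarrow> hom_part j b y x = 0"
    "\<And>j. 1 \<le> j \<Longrightarrow> j < h \<Longrightarrow> hom_part j b w x = 0"
  shows "b (shift y c x) = b y + c ^ h * (b (shift w 1 x) - b w)"
  using poly_fun_expand_top[OF assms(1,2,3,4)] poly_fun_expand_top[OF assms(1,2,3,5), of 1]
    hom_part_top_indep[OF assms(1,2,3), of y x w] by simp

section \<open>Vectors that change one polynomial by a product\<close>

text \<open>
  Induction on \<open>h\<close>: if \<open>u\<close> and \<open>v\<close> are linear forms, then \<open>u\<^sup>h v\<close> is up to the factor \<open>h + 1\<close> the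
  coefficient of \<open>s\<close> in \<open>(u + s v)\<^bsup>h+1\<^esup>\<close>, which a power sum over \<open>s\<close> extracts.
\<close>

lemma product_as_sum_of_powers:
  assumes "h < CARD('p::prime_card)"
  shows "\<exists>S :: ('p mod_ring \<times> (nat \<Rightarrow> 'p mod_ring)) list. \<forall>c.
    (\<Prod>j<h. c j) = (\<Sum>(\<rho>, a)\<leftarrow>S. \<rho> * (\<Sum>j<h. a j * c j) ^ h)"
  using assms
proof (induction h)
  case 0
  show ?case by (intro exI[of _ "[(1, \<lambda>_. 0)]"]) simp
next
  case (Suc h)
  let ?p = "CARD('p)"
  obtain S :: "('p mod_ring \<times> (nat \<Rightarrow> 'p mod_ring)) list" where
    S: "\<And>c. (\<Prod>j<h. c j) = (\<Sum>(\<rho>, a)\<leftarrow>S. \<rho> * (\<Sum>j<h. a j * c j) ^ h)"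
    using Suc by auto
  obtain us :: "'p mod_ring list" where us: "set us = UNIV" "distinct us"
    using finite_distinct_list[of "UNIV :: 'p mod_ring set"] by auto
  define e :: "'p mod_ring" where "e = of_nat (Suc h)"
  have "e \<noteq> 0"
    using of_nat_0_mod_ring_dvd[of "Suc h", where 'a='p] Suc.prems unfolding e_def
    by (metis dvd_imp_le leD zero_less_Suc)
  have step: "u ^ h * v = (\<Sum>s\<leftarrow>us. - (s ^ (?p - 2) / e) * (u + s * v) ^ Suc h)" for u v :: "'p mod_ring"
  proof -
    have "degree ([:u, v:] ^ Suc h) \<le> Suc h"
      using degree_power_le[of "[:u, v:]" "Suc h"] by (simp split: if_splits)
    then have "(\<Sum>s\<in>UNIV. s ^ (?p - 1 - 1) * poly ([:u, v:] ^ Suc h) s) = - (e * u ^ h * v)"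
      using Suc.prems by (subst coeff_by_power_sum) (auto simp: coeff_linear_poly_power e_def simp del: power_Suc)
    then have "u ^ h * v = - (1 / e) * (\<Sum>s\<in>UNIV. s ^ (?p - 1 - 1) * poly ([:u, v:] ^ Suc h) s)"
      using \<open>e \<noteq> 0\<close> by simp
    also have "\<dots> = (\<Sum>s\<in>UNIV. - (s ^ (?p - 2) / e) * (u + s * v) ^ Suc h)"
      unfolding sum_distrib_left by (intro sum.cong) (simp_all add: numeral_2_eq_2 algebra_simps)
    also have "\<dots> = (\<Sum>s\<leftarrow>us. - (s ^ (?p - 2) / e) * (u + s * v) ^ Suc h)"
      using us by (simp add: sum_list_distinct_conv_sum_set)
    finally show ?thesis .
  qed
  define S' where "S' = concat (map (\<lambda>(\<rho>, a). map (\<lambda>s. (- (\<rho> * s ^ (?p - 2) / e), a(h := s))) us) S)"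
  have "(\<Prod>j<Suc h. c j) = (\<Sum>(\<rho>, a)\<leftarrow>S'. \<rho> * (\<Sum>j<Suc h. a j * c j) ^ Suc h)" for c
  proof -
    have "(\<Sum>s\<leftarrow>us. - (\<rho> * s ^ (?p - 2) / e) * ((\<Sum>j<h. a j * c j) + s * c h) ^ Suc h)
        = \<rho> * ((\<Sum>j<h. a j * c j) ^ h * c h)" for \<rho> a
      unfolding step sum_list_const_mult[symmetric] by (simp add: algebra_simps)
    then have "(\<Sum>(\<rho>, a)\<leftarrow>S'. \<rho> * (\<Sum>j<Suc h. a j * c j) ^ Suc h)
        = (\<Sum>(\<rho>, a)\<leftarrow>S. \<rho> * ((\<Sum>j<h. a j * c j) ^ h * c h))"
      unfolding S'_def
      by (induction S) (simp_all add: o_def case_prod_unfold del: power_Suc)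
    also have "\<dots> = (\<Sum>(\<rho>, a)\<leftarrow>S. \<rho> * (\<Sum>j<h. a j * c j) ^ h) * c h"
      by (simp add: case_prod_unfold sum_list_mult_const[symmetric] mult.assoc)
    finally show ?thesis by (simp add: S)
  qed
  then show ?case by blast
qed

definition lincomb :: "nat \<Rightarrow> (nat \<Rightarrow> 'a) \<Rightarrow> (nat \<Rightarrow> nat \<Rightarrow> 'a) \<Rightarrow> nat \<Rightarrow> 'a::comm_ring_1"
  where "lincomb h c k = (\<lambda>i. \<Sum>j<h. c j * k j i)"

lemma lincomb_0 [simp]: "lincomb 0 c k = (\<lambda>_. 0)"
  by (simp add: lincomb_def)

lemma lincomb_Suc: "lincomb (Suc h) c k = shift (lincomb h c k) (c h) (k h)"
  by (simp add: lincomb_def shift_def)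

lemma lincomb_cong: "(\<And>j. j < h \<Longrightarrow> c j = c' j) \<Longrightarrow> (\<And>j. j < h \<Longrightarrow> k j = k' j) \<Longrightarrow> lincomb h c k = lincomb h c' k'"
  by (auto simp: lincomb_def)

lemma lincomb_lincomb: "lincomb h c (\<lambda>j. lincomb L (\<lambda>i. a i j) k) = lincomb L (\<lambda>i. \<Sum>j<h. a i j * c j) k"
  unfolding lincomb_def sum_distrib_left sum_distrib_right
  by (subst sum.swap) (simp add: algebra_simps)

definition agree :: "('v \<Rightarrow> 'a) set \<Rightarrow> 'v \<Rightarrow> 'v \<Rightarrow> bool"
  where "agree B x y \<longleftrightarrow> (\<forall>b\<in>B. b x = b y)"

lemma agree_Un: "agree (A \<union> B) x y \<longleftrightarrow> agree A x y \<and> agree B x y"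
  by (auto simp: agree_def)

abbreviation origin :: "nat \<Rightarrow> 'a::zero" where "origin \<equiv> (\<lambda>_. 0)"

definition lower_parts :: "nat \<Rightarrow> 'p::prime_card point set \<Rightarrow> ('p point \<Rightarrow> 'p mod_ring) set \<Rightarrow> ('p point \<Rightarrow> 'p mod_ring) set"
  where "lower_parts h Y T = (\<Union>b\<in>T. \<Union>y\<in>Y. (\<lambda>j. hom_part j b y) ` {1..<h})"

lemma poly_fun_lower_parts:
  assumes "\<forall>b\<in>T. poly_fun n h b" "h < CARD('p::prime_card)" "l \<in> lower_parts h Y (T :: ('p point \<Rightarrow> 'p mod_ring) set)"
  shows "poly_fun n (h - 1) l"
proof -
  obtain b y j where l: "l = hom_part j b y" "b \<in> T" "1 \<le> j" "j < h"
    using assms(3) by (auto simp: lower_parts_def)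
  then have "poly_fun n j l" using poly_fun_hom_part_direction assms by (metis less_trans)
  then show ?thesis by (rule poly_fun_mono) (use l in auto)
qed

lemma card_lower_parts:
  assumes "finite T" "finite Y"
  shows "finite (lower_parts h Y T)" "card (lower_parts h Y T) \<le> card T * (card Y * h)"
proof -
  show "finite (lower_parts h Y T)" unfolding lower_parts_def using assms by auto
  have "card (\<Union>y\<in>Y. (\<lambda>j. hom_part j b y) ` {1..<h}) \<le> card Y * h" for b
  proof -
    have "card ((\<lambda>j. hom_part j b y) ` {1..<h}) \<le> h" for y
      by (rule order_trans[OF card_image_le]) auto
    then show ?thesis
      by (intro order_trans[OF card_UN_le[OF assms(2)]] order_trans[OF sum_bounded_above[where K=h]]) auto
  qed
  then show "card (lower_parts h Y T) \<le> card T * (card Y * h)"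
    unfolding lower_parts_def
    by (intro order_trans[OF card_UN_le[OF assms(1)]] order_trans[OF sum_bounded_above[where K="card Y * h"]]) auto
qed

text \<open>
  The condition that the lower parts vanish is stated as lying in a common level set of polynomials
  of degree at most \<open>h - 1\<close>, all of which vanish at the origin.
\<close>

lemma additive_of_agree_lower_parts:
  fixes b :: "'p::prime_card point \<Rightarrow> 'p mod_ring"
  assumes "poly_fun n h b" "h < CARD('p)" "1 \<le> h" "b \<in> T" "y \<in> Y" "w \<in> Y"
    "agree (lower_parts h Y T) x origin"
  shows "b (shift y c x) = b y + c ^ h * (b (shift w 1 x) - b w)"
proof (rule additive_of_lower_hom_parts_zero[OF assms(1-3)])
  have *: "hom_part j b z x = 0" if "1 \<le> j" "j < h" "z \<in> Y" for j z
  proof -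
    have "hom_part j b z x = hom_part j b z origin"
      using assms(4,7) that unfolding agree_def lower_parts_def by (meson UN_I atLeastLessThan_iff imageI)
    then show ?thesis using hom_part_zero_direction[of j b z] that assms(2) by simp
  qed
  show "hom_part j b y x = 0" "hom_part j b w x = 0" if "1 \<le> j" "j < h" for j
    using * that assms by auto
qed

text \<open>
  Suppose that \<open>\<beta>\<close> attains one value \<open>\<beta> origin + v\<close> with \<open>v \<noteq> 0\<close> on the level set given by \<open>T\<close> and any
  \<open>G\<close> polynomials of lower degree. Adding up \<open>m\<close> such points, each of them chosen additively with
  respect to the sum of the previous ones, gives the value \<open>\<beta> origin + m v\<close>, and the multiples of \<open>v\<close>
  fill the prime field. Otherwise every \<open>v \<noteq> 0\<close> is excluded by some \<open>G\<close> polynomials of lower degree,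
  and all these exceptional families together force \<open>\<beta>\<close> to be constant.
\<close>

lemma constant_or_hits:
  fixes \<beta> :: "'p::prime_card point \<Rightarrow> 'p mod_ring"
  assumes T: "\<forall>b\<in>T. poly_fun n h b" "finite T" and \<beta>: "poly_fun n h \<beta>" and h: "1 \<le> h" "h < CARD('p)"
    and G: "N + (Suc (card T) + N) * (2 * h) \<le> G"
  shows "(\<exists>B. finite B \<and> card B \<le> CARD('p) * G \<and> (\<forall>b\<in>B. poly_fun n (h - 1) b) \<and>
      (\<forall>x. agree (T \<union> B) x origin \<longrightarrow> \<beta> x = \<beta> origin)) \<or>
    (\<forall>\<rho> B. finite B \<and> card B \<le> N \<and> (\<forall>b\<in>B. poly_fun n (h - 1) b) \<longrightarrow>
      (\<exists>x. agree (T \<union> B) x origin \<and> \<beta> x = \<beta> origin + \<rho>))"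
proof -
  define R where "R v B \<longleftrightarrow> finite B \<and> card B \<le> G \<and> (\<forall>b\<in>B. poly_fun n (h - 1) b) \<and>
      (\<forall>x. agree (T \<union> B) x origin \<longrightarrow> \<beta> x \<noteq> \<beta> origin + v)" for v B
  show ?thesis
  proof (cases "\<forall>v. v \<noteq> 0 \<longrightarrow> (\<exists>B. R v B)")
    case False
    then obtain v where v: "v \<noteq> 0" and notR: "\<And>B. \<not> R v B"
      by blast
    have hit: "\<exists>x. agree (T \<union> B) x origin \<and> \<beta> x = \<beta> origin + v"
      if "finite B" "card B \<le> G" "\<forall>b\<in>B. poly_fun n (h - 1) b" for B
      using notR[of B] that unfolding R_def by blast
    have "\<exists>x. agree (T \<union> B) x origin \<and> \<beta> x = \<beta> origin + of_nat m * v"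
      if B: "finite B" "card B \<le> N" "\<forall>b\<in>B. poly_fun n (h - 1) b" for m :: nat and B
    proof (induction m)
      case 0
      show ?case by (intro exI[of _ origin]) (simp add: agree_def)
    next
      case (Suc m)
      then obtain x where x: "agree (T \<union> B) x origin" "\<beta> x = \<beta> origin + of_nat m * v" by blast
      define U where "U = insert \<beta> (T \<union> B)"
      have U: "\<forall>b\<in>U. poly_fun n h b" "finite U"
        using T B \<beta> poly_fun_mono[of n "h - 1" _ h] by (auto simp: U_def)
      have "card U \<le> Suc (card T) + N"
        using card_Un_le[of T B] B(2) T B(1) by (auto simp: U_def card_insert_if)
      \<comment> \<open>adding these polynomials makes the next point additive to \<open>x\<close>, also for the members of \<open>B\<close>\<close>
      define B' where "B' = B \<union> lower_parts h {x, origin} U"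
      have "card {x, origin} \<le> 2" by (simp add: card_insert_if)
      have "card (lower_parts h {x, origin} U) \<le> card U * (card {x, origin} * h)"
        by (intro card_lower_parts U) simp
      also have "\<dots> \<le> (Suc (card T) + N) * (2 * h)"
        by (intro mult_le_mono \<open>card U \<le> _\<close> \<open>card {x, origin} \<le> 2\<close> order_refl)
      finally have "card B' \<le> G"
        unfolding B'_def using card_Un_le[of B "lower_parts h {x, origin} U"] B(2) G by linarith
      moreover have "finite B'" unfolding B'_def by (intro finite_UnI card_lower_parts(1) U B) simp
      moreover have "\<forall>b\<in>B'. poly_fun n (h - 1) b"
        unfolding B'_def using B(3) poly_fun_lower_parts[OF U(1) h(2)] by blast
      ultimately obtain z where z: "agree (T \<union> B') z origin" "\<beta> z = \<beta> origin + v"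
        using hit by blast
      have "b (shift x 1 z) = b x + (b z - b origin)" if "b \<in> U" for b
        using additive_of_agree_lower_parts[of n h b U x "{x, origin}" origin z 1] that U h z(1)
        by (simp add: B'_def agree_Un)
      note eq = this
      have "b (shift x 1 z) = b origin" if "b \<in> T \<union> B" for b
      proof -
        have "b x = b origin" "b z = b origin" using x(1) z(1) that by (auto simp: agree_def B'_def)
        then show ?thesis using eq[of b] that by (simp add: U_def)
      qed
      moreover have "\<beta> (shift x 1 z) = \<beta> origin + of_nat (Suc m) * v"
        using eq[of \<beta>] x(2) z(2) by (simp add: U_def algebra_simps)
      ultimately show ?case unfolding agree_def by blast
    qed
    moreover have "\<exists>m. \<rho> = of_nat m * v" for \<rho>
      using surj_of_nat_mod_ring[of "\<rho> / v"] v by (metis nonzero_eq_divide_eq)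
    ultimately show ?thesis by metis
  next
    case True
    then have ex: "\<exists>B. R v B" if "v \<noteq> 0" for v using that by blast
    define C where "C v = (SOME B. R v B)" for v
    have C: "R v (C v)" if "v \<noteq> 0" for v
      unfolding C_def using ex[OF that] by (rule someI_ex)
    define B where "B = (\<Union>v\<in>UNIV - {0}. C v)"
    have "card B \<le> (\<Sum>v\<in>UNIV - {0}. card (C v))"
      unfolding B_def by (intro card_UN_le) simp
    also have "\<dots> \<le> (\<Sum>v\<in>(UNIV :: 'p mod_ring set) - {0}. G)"
      by (intro sum_mono) (use C in \<open>auto simp: R_def\<close>)
    also have "\<dots> \<le> CARD('p) * G"
      by (simp add: card_Diff_singleton)
    finally have "card B \<le> CARD('p) * G" .
    moreover have "finite B" "\<forall>b\<in>B. poly_fun n (h - 1) b" using C by (auto simp: B_def R_def)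
    moreover have "\<beta> x = \<beta> origin" if "agree (T \<union> B) x origin" for x
    proof (rule ccontr)
      assume "\<beta> x \<noteq> \<beta> origin"
      then have nz: "\<beta> x - \<beta> origin \<noteq> 0" by simp
      then have "C (\<beta> x - \<beta> origin) \<subseteq> B" using nz unfolding B_def by (intro UN_upper) simp
      then have "agree (T \<union> C (\<beta> x - \<beta> origin)) x origin"
        using that unfolding agree_def by blast
      then show False using C[OF nz] by (auto simp: R_def)
    qed
    ultimately show ?thesis by blast
  qed
qed

lemma card_lincomb_range:
  fixes k :: "nat \<Rightarrow> 'p::prime_card point"
  shows "finite (range (\<lambda>c. lincomb L c k))" "card (range (\<lambda>c. lincomb L c k)) \<le> CARD('p) ^ L"
proof -
  let ?E = "{..<L} \<rightarrow>\<^sub>E (UNIV :: 'p mod_ring set)"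
  have "lincomb L c k \<in> (\<lambda>c. lincomb L c k) ` ?E" for c
    by (rule image_eqI[of _ _ "restrict c {..<L}"]) (auto intro: lincomb_cong)
  then have sub: "range (\<lambda>c. lincomb L c k) \<subseteq> (\<lambda>c. lincomb L c k) ` ?E" by blast
  have fin: "finite ?E" by (intro finite_PiE) auto
  show "finite (range (\<lambda>c. lincomb L c k))" using finite_subset[OF sub] fin by blast
  have "card ?E = CARD('p) ^ L" by (simp add: card_PiE)
  then show "card (range (\<lambda>c. lincomb L c k)) \<le> CARD('p) ^ L"
    using card_mono[OF finite_imageI[OF fin] sub] card_image_le[OF fin, of "\<lambda>c. lincomb L c k"] by simp
qed

text \<open>
  The vectors are chosen one after the other, each additive over all linear combinations of the
  previous ones; the increment of \<open>\<beta>\<close> is then \<open>h\<close>-homogeneous in each coefficient.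
\<close>

lemma diagonal_system:
  fixes \<beta> :: "'p::prime_card point \<Rightarrow> 'p mod_ring"
  assumes T: "\<forall>b\<in>T. poly_fun n h b" "finite T" and \<beta>: "poly_fun n h \<beta>" and h: "1 \<le> h" "h < CARD('p)"
    and N: "Suc (card T) * (CARD('p) ^ L * h) \<le> N"
    and hits: "\<And>\<rho> B. finite B \<Longrightarrow> card B \<le> N \<Longrightarrow> \<forall>b\<in>B. poly_fun n (h - 1) b \<Longrightarrow>
      \<exists>x. agree (T \<union> B) x origin \<and> \<beta> x = \<beta> origin + \<rho>"
  shows "\<exists>k. \<forall>c. agree T (lincomb L c k) origin \<and>
    \<beta> (lincomb L c k) = \<beta> origin + (\<Sum>i<L. \<rho> i * c i ^ h)"
proof -
  have "l \<le> L \<Longrightarrow> \<exists>k. \<forall>c. agree T (lincomb l c k) origin \<and>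
    \<beta> (lincomb l c k) = \<beta> origin + (\<Sum>i<l. \<rho> i * c i ^ h)" for l
  proof (induction l)
    case 0
    show ?case by (simp add: agree_def)
  next
    case (Suc l)
    then obtain k where k: "\<And>c. agree T (lincomb l c k) origin"
      "\<And>c. \<beta> (lincomb l c k) = \<beta> origin + (\<Sum>i<l. \<rho> i * c i ^ h)"
      by auto
    define U where "U = insert \<beta> T"
    define Y where "Y = range (\<lambda>c. lincomb l c k)"
    have U: "\<forall>b\<in>U. poly_fun n h b" "finite U" "card U \<le> Suc (card T)"
      using T \<beta> by (auto simp: U_def card_insert_if)
    have Y: "finite Y" "card Y \<le> CARD('p) ^ l"
      unfolding Y_def by (rule card_lincomb_range)+
    have "lincomb l (\<lambda>_. 0) k = origin" by (simp add: lincomb_def)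
    then have "origin \<in> Y" unfolding Y_def by (metis rangeI)
    have "card (lower_parts h Y U) \<le> card U * (card Y * h)"
      by (rule card_lower_parts[OF U(2) Y(1)])
    also have "\<dots> \<le> Suc (card T) * (CARD('p) ^ L * h)"
      using Suc.prems by (intro mult_le_mono U(3) order_trans[OF Y(2)] power_increasing order_refl) auto
    finally have "card (lower_parts h Y U) \<le> N" using N by linarith
    then obtain x where x: "agree (T \<union> lower_parts h Y U) x origin" "\<beta> x = \<beta> origin + \<rho> l"
      using hits[of "lower_parts h Y U"] card_lower_parts(1)[OF U(2) Y(1)] poly_fun_lower_parts[OF U(1) h(2)] by blast
    define k' where "k' = k(l := x)"
    have "lincomb l c k' = lincomb l c k" for c
      by (rule lincomb_cong) (auto simp: k'_def)
    then have lincomb_k': "lincomb (Suc l) c k' = shift (lincomb l c k) (c l) x" for c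
      by (simp add: lincomb_Suc k'_def)
    have step: "b (lincomb (Suc l) c k') = b (lincomb l c k) + c l ^ h * (b x - b origin)" if "b \<in> U" for b c
      using additive_of_agree_lower_parts[of n h b U "lincomb l c k" Y origin x "c l"] U(1) that h x(1)
        \<open>origin \<in> Y\<close> unfolding lincomb_k' by (auto simp: Y_def agree_Un)
    have "agree T (lincomb (Suc l) c k') origin" for c
      unfolding agree_def
    proof
      fix b assume "b \<in> T"
      then show "b (lincomb (Suc l) c k') = b origin"
        using step[of b c] k(1)[of c] x(1) by (auto simp: U_def agree_def)
    qed
    moreover have "\<beta> (lincomb (Suc l) c k') = \<beta> origin + (\<Sum>i<Suc l. \<rho> i * c i ^ h)" for c
      using step[of \<beta> c] by (simp add: U_def k(2) x(2) algebra_simps)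
    ultimately show ?case by blast
  qed
  then show ?thesis by blast
qed

text \<open>
  A linear substitution turns the diagonal form of degree \<open>h\<close> into the product of \<open>h\<close> variables. The
  product is preferred to a sum of powers because the equation \<open>c\<^sub>1 \<cdots> c\<^sub>h = u\<close> with \<open>u \<noteq> 0\<close> describes a
  coset of a torus, over which monomials can be summed.
\<close>

lemma constant_or_product_system:
  assumes h: "1 \<le> h" "h < CARD('p::prime_card)"
  shows "\<exists>C. \<forall>n T (\<beta> :: 'p point \<Rightarrow> 'p mod_ring).
    (\<forall>b\<in>T. poly_fun n h b) \<and> finite T \<and> card T \<le> M \<and> poly_fun n h \<beta> \<longrightarrow>
    (\<exists>B. finite B \<and> card B \<le> C \<and> (\<forall>b\<in>B. poly_fun n (h - 1) b) \<and>
      (\<forall>x. agree (T \<union> B) x origin \<longrightarrow> \<beta> x = \<beta> origin)) \<or>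
    (\<exists>k. \<forall>c. agree T (lincomb h c k) origin \<and> \<beta> (lincomb h c k) = \<beta> origin + (\<Prod>j<h. c j))"
proof -
  obtain S :: "('p mod_ring \<times> (nat \<Rightarrow> 'p mod_ring)) list" where
    S: "\<And>c. (\<Prod>j<h. c j) = (\<Sum>(\<rho>, a)\<leftarrow>S. \<rho> * (\<Sum>j<h. a j * c j) ^ h)"
    using product_as_sum_of_powers[OF h(2)] by blast
  define L where "L = length S"
  define \<rho> where "\<rho> i = fst (S ! i)" for i
  define a where "a i = snd (S ! i)" for i
  have prod: "(\<Prod>j<h. c j) = (\<Sum>i<L. \<rho> i * (\<Sum>j<h. a i j * c j) ^ h)" for c
    unfolding S L_def \<rho>_def a_def
    by (simp add: sum_list_sum_nth case_prod_unfold atLeast0LessThan)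
  define N where "N = Suc M * (CARD('p) ^ L * h)"
  define G where "G = N + (Suc M + N) * (2 * h)"
  have "(\<exists>B. finite B \<and> card B \<le> CARD('p) * G \<and> (\<forall>b\<in>B. poly_fun n (h - 1) b) \<and>
      (\<forall>x. agree (T \<union> B) x origin \<longrightarrow> \<beta> x = \<beta> origin)) \<or>
    (\<exists>k. \<forall>c. agree T (lincomb h c k) origin \<and> \<beta> (lincomb h c k) = \<beta> origin + (\<Prod>j<h. c j))"
    if T: "\<forall>b\<in>T. poly_fun n h b" "finite T" "card T \<le> M" and \<beta>: "poly_fun n h \<beta>"
    for n T and \<beta> :: "'p point \<Rightarrow> 'p mod_ring"
  proof -
    have G': "N + (Suc (card T) + N) * (2 * h) \<le> G" unfolding G_def using T(3) by simp
    have N': "Suc (card T) * (CARD('p) ^ L * h) \<le> N" unfolding N_def using T(3) by simp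
    consider "\<exists>B. finite B \<and> card B \<le> CARD('p) * G \<and> (\<forall>b\<in>B. poly_fun n (h - 1) b) \<and>
        (\<forall>x. agree (T \<union> B) x origin \<longrightarrow> \<beta> x = \<beta> origin)"
      | "\<And>\<rho> B. finite B \<Longrightarrow> card B \<le> N \<Longrightarrow> \<forall>b\<in>B. poly_fun n (h - 1) b \<Longrightarrow>
        \<exists>x. agree (T \<union> B) x origin \<and> \<beta> x = \<beta> origin + \<rho>"
      using constant_or_hits[OF T(1,2) \<beta> h G'] by blast
    then show ?thesis
    proof cases
      case 2
      obtain k where k: "\<And>c. agree T (lincomb L c k) origin"
        "\<And>c. \<beta> (lincomb L c k) = \<beta> origin + (\<Sum>i<L. \<rho> i * c i ^ h)"
        using diagonal_system[OF T(1,2) \<beta> h N' 2, of \<rho>] by blast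
      define k' where "k' j = lincomb L (\<lambda>i. a i j) k" for j
      have "agree T (lincomb h c k') origin \<and> \<beta> (lincomb h c k') = \<beta> origin + (\<Prod>j<h. c j)" for c
        unfolding k'_def lincomb_lincomb prod using k by blast
      then show ?thesis by blast
    qed blast
  qed
  then show ?thesis by blast
qed

section \<open>Functions determined by few polynomials of low degree\<close>

lemma shift_1_commute: "shift x 1 y = shift y 1 x"
  by (auto simp: shift_def)

lemma poly_fun_shift: "poly_fun n d f \<Longrightarrow> poly_fun n d (\<lambda>x. f (shift x c k))"
proof (induction rule: poly_fun.induct)
  case (coord i d)
  then have "poly_fun n (Suc d) (\<lambda>x. x i + c * k i)" by (intro poly_fun.intros)
  then show ?case by (simp add: shift_def)
qed (auto intro: poly_fun.intros)

text \<open>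
  The family may depend on the point \<open>w\<close>; only its size is bounded.
\<close>

definition determined :: "nat \<Rightarrow> nat \<Rightarrow> nat \<Rightarrow> ('p::prime_card point \<Rightarrow> 'p mod_ring) \<Rightarrow> bool"
  where "determined n g m f \<longleftrightarrow> (\<forall>w. \<exists>B. finite B \<and> card B \<le> m \<and> (\<forall>b\<in>B. poly_fun n g b) \<and>
    (\<forall>x. agree B x w \<longrightarrow> f x = f w))"

lemma determinedD:
  "determined n g m f \<Longrightarrow> \<exists>B. finite B \<and> card B \<le> m \<and> (\<forall>b\<in>B. poly_fun n g b) \<and>
    (\<forall>x. agree B x w \<longrightarrow> f x = f w)"
  unfolding determined_def by blast

lemma determined_mono: "determined n g m f \<Longrightarrow> m \<le> m' \<Longrightarrow> determined n g m' f"
  unfolding determined_def by (meson order_trans)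

lemma determined_const: "determined n g m (\<lambda>_. c)"
  unfolding determined_def by (intro allI exI[of _ "{}"]) auto

lemma determined_poly_fun: "poly_fun n g f \<Longrightarrow> determined n g 1 f"
  unfolding determined_def by (intro allI exI[of _ "{f}"]) (auto simp: agree_def)

lemma determined_map: "determined n g m f \<Longrightarrow> determined n g m (\<lambda>x. F (f x))"
  unfolding determined_def by metis

lemma determined_map2:
  assumes "determined n g m f" "determined n g m' f'"
  shows "determined n g (m + m') (\<lambda>x. F (f x) (f' x))"
  unfolding determined_def
proof
  fix w
  obtain B where B: "finite B" "card B \<le> m" "\<forall>b\<in>B. poly_fun n g b" "\<And>x. agree B x w \<Longrightarrow> f x = f w"
    using determinedD[OF assms(1), of w] by blast
  obtain B' where B': "finite B'" "card B' \<le> m'" "\<forall>b\<in>B'. poly_fun n g b" "\<And>x. agree B' x w \<Longrightarrow> f' x = f' w"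
    using determinedD[OF assms(2), of w] by blast
  have "card (B \<union> B') \<le> m + m'"
    using card_Un_le[of B B'] B(2) B'(2) by linarith
  then show "\<exists>B. finite B \<and> card B \<le> m + m' \<and> (\<forall>b\<in>B. poly_fun n g b) \<and>
      (\<forall>x. agree B x w \<longrightarrow> F (f x) (f' x) = F (f w) (f' w))"
    using B B' by (intro exI[of _ "B \<union> B'"]) (auto simp: agree_Un)
qed

lemma determined_sum:
  assumes "finite I" "\<And>i. i \<in> I \<Longrightarrow> determined n g m (f i)"
  shows "determined n g (card I * m) (\<lambda>x. \<Sum>i\<in>I. f i x)"
  using assms
proof (induction I rule: finite_induct)
  case (insert i I)
  have "determined n g (m + card I * m) (\<lambda>x. f i x + (\<Sum>i\<in>I. f i x))"
    using insert by (intro determined_map2[where F="(+)"]) auto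
  then show ?case using insert.hyps by simp
qed (simp add: determined_const)

lemma determined_shift:
  assumes "determined n g m f"
  shows "determined n g m (\<lambda>x. f (shift x c k))"
  unfolding determined_def
proof
  fix w
  obtain B where B: "finite B" "card B \<le> m" "\<forall>b\<in>B. poly_fun n g b"
    "\<And>x. agree B x (shift w c k) \<Longrightarrow> f x = f (shift w c k)"
    using determinedD[OF assms, of "shift w c k"] by blast
  let ?B = "(\<lambda>b x. b (shift x c k)) ` B"
  have "card ?B \<le> m" using card_image_le[OF B(1)] B(2) by (rule order_trans)
  moreover have "f (shift x c k) = f (shift w c k)" if "agree ?B x w" for x
    using that by (intro B(4)) (auto simp: agree_def)
  moreover have "\<forall>b\<in>?B. poly_fun n g b"
  proof
    fix b' assume "b' \<in> ?B"
    then obtain b where "b \<in> B" "b' = (\<lambda>x. b (shift x c k))" by blast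
    then show "poly_fun n g b'" using B(3) poly_fun_shift[of n g b c k] by simp
  qed
  ultimately show "\<exists>B. finite B \<and> card B \<le> m \<and> (\<forall>b\<in>B. poly_fun n g b) \<and>
      (\<forall>x. agree B x w \<longrightarrow> f (shift x c k) = f (shift w c k))"
    using B(1) by (intro exI[of _ ?B]) simp
qed

lemma determined_hom_part:
  fixes f :: "'p::prime_card point \<Rightarrow> 'p mod_ring"
  assumes "determined n g m f"
  shows "determined n g (CARD('p) * m) (\<lambda>x. hom_part j f x k)"
proof -
  have "determined n g m (\<lambda>x. c ^ (CARD('p) - 1 - j) * f (shift x c k))" for c
    using determined_map[OF determined_shift[OF assms]] .
  then have "determined n g (card (UNIV :: 'p mod_ring set) * m)
      (\<lambda>x. \<Sum>c\<in>UNIV. c ^ (CARD('p) - 1 - j) * f (shift x c k))"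
    by (intro determined_sum) auto
  from determined_map[OF this, of uminus] show ?thesis
    by (simp add: hom_part_def)
qed

section \<open>Division by a polynomial with a product system\<close>

text \<open>
  Multiplicative Fourier coefficient of \<open>f\<close> along the direction \<open>k\<close>. For \<open>0 < m < p - 1\<close> it is the
  homogeneous part of degree \<open>m\<close> up to sign, because \<open>inverse c ^ m = c ^ (p - 1 - m)\<close>.
\<close>

definition torus_op :: "nat \<Rightarrow> 'p::prime_card point \<Rightarrow> ('p point \<Rightarrow> 'p mod_ring) \<Rightarrow> 'p point \<Rightarrow> 'p mod_ring"
  where "torus_op m k f = (\<lambda>x. \<Sum>c\<in>UNIV - {0}. inverse c ^ m * f (shift x c k))"

lemma determined_torus_op:
  fixes f :: "'p::prime_card point \<Rightarrow> 'p mod_ring"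
  assumes "determined n g m f"
  shows "determined n g (CARD('p) * m) (torus_op j k f)"
proof -
  have "determined n g m (\<lambda>x. inverse c ^ j * f (shift x c k))" for c
    using determined_map[OF determined_shift[OF assms]] .
  then have "determined n g (card (UNIV - {0 :: 'p mod_ring}) * m) (torus_op j k f)"
    unfolding torus_op_def by (intro determined_sum) auto
  then show ?thesis by (rule determined_mono) (simp add: card_Diff_singleton)
qed

lemma torus_op_eq_hom_part:
  fixes f :: "'p::prime_card point \<Rightarrow> 'p mod_ring"
  assumes "1 \<le> m" "m < CARD('p) - 1"
  shows "torus_op m k f x = - hom_part m f x k"
proof -
  have inv: "inverse c ^ m = c ^ (CARD('p) - 1 - m)" if "c \<noteq> 0" for c :: "'p mod_ring"
  proof -
    have "c ^ m * c ^ (CARD('p) - 1 - m) = 1"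
      using power_card_minus_one[OF that] assms by (simp flip: power_add)
    then have "inverse (c ^ m) = c ^ (CARD('p) - 1 - m)" by (rule inverse_unique)
    then show ?thesis by (simp add: power_inverse)
  qed
  have "torus_op m k f x = (\<Sum>c\<in>UNIV - {0}. c ^ (CARD('p) - 1 - m) * f (shift x c k))"
    unfolding torus_op_def by (intro sum.cong) (auto simp: inv)
  also have "\<dots> = (\<Sum>c\<in>UNIV. c ^ (CARD('p) - 1 - m) * f (shift x c k))"
    using assms by (intro sum.mono_neutral_left) (auto simp: zero_power)
  finally show ?thesis by (simp add: hom_part_def)
qed

text \<open>
  The sum over all \<open>c\<close> is minus the part of degree \<open>p - 1\<close>. That part does not depend on \<open>x\<close>, so it
  vanishes as soon as \<open>f\<close> vanishes on the line through the origin.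
\<close>

lemma torus_op_0_eq_uminus:
  fixes f :: "'p::prime_card point \<Rightarrow> 'p mod_ring"
  assumes "poly_fun n d f" "d < CARD('p)" "\<And>c. f (shift origin c k) = 0"
  shows "torus_op 0 k f x = - f x" "hom_part (CARD('p) - 1) f x k = 0"
proof -
  let ?p = "CARD('p)"
  have f: "poly_fun n (?p - 1) f" by (rule poly_fun_mono[OF assms(1)]) (use assms(2) in simp)
  have "hom_part (?p - 1) f x k = hom_part (?p - 1) f origin k"
    by (rule hom_part_top_indep[OF f]) (use prime_card_gt_1[where 'p='p] in auto)
  also have "\<dots> = 0" unfolding hom_part_def assms(3) by simp
  finally show zero: "hom_part (?p - 1) f x k = 0" .
  have "torus_op 0 k f x = (\<Sum>c\<in>UNIV. f (shift x c k)) - f x"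
    unfolding torus_op_def by (simp add: sum_diff1)
  then show "torus_op 0 k f x = - f x"
    using zero by (simp add: hom_part_def)
qed

primrec torus_ops :: "nat \<Rightarrow> nat \<Rightarrow> (nat \<Rightarrow> 'p::prime_card point) \<Rightarrow> ('p point \<Rightarrow> 'p mod_ring) \<Rightarrow> 'p point \<Rightarrow> 'p mod_ring"
  where "torus_ops m 0 k f = f"
  | "torus_ops m (Suc l) k f = torus_op m (k l) (torus_ops m l k f)"

lemma determined_torus_ops:
  fixes f :: "'p::prime_card point \<Rightarrow> 'p mod_ring"
  assumes "determined n g m f"
  shows "determined n g (CARD('p) ^ l * m) (torus_ops j l k f)"
proof (induction l)
  case (Suc l)
  then show ?case using determined_torus_op[OF Suc] by (simp add: mult.assoc)
qed (simp add: assms)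

lemma torus_ops_of_zero: "(\<And>x. f x = 0) \<Longrightarrow> torus_ops m l k f x = 0"
proof (induction l arbitrary: x)
  case (Suc l)
  then show ?case by (simp add: torus_op_def)
qed simp

lemma poly_fun_torus_ops:
  fixes f :: "'p::prime_card point \<Rightarrow> 'p mod_ring"
  assumes "poly_fun n d f" "d < CARD('p)" "1 \<le> m" "m < CARD('p) - 1"
  shows "(\<forall>x. torus_ops m l k f x = 0) \<or> (l * m \<le> d \<and> poly_fun n (d - l * m) (torus_ops m l k f))"
proof (induction l)
  case 0
  then show ?case using assms by simp
next
  case (Suc l)
  have eq: "torus_ops m (Suc l) k f = (\<lambda>x. - hom_part m (torus_ops m l k f) x (k l))"
    using torus_op_eq_hom_part[OF assms(3,4)] by auto
  from Suc show ?case
  proof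
    assume "\<forall>x. torus_ops m l k f x = 0"
    then have "torus_ops m l k f = (\<lambda>_. 0)" by blast
    then show ?thesis unfolding eq by (simp add: hom_part_def)
  next
    assume *: "l * m \<le> d \<and> poly_fun n (d - l * m) (torus_ops m l k f)"
    show ?thesis
    proof (cases "m \<le> d - l * m")
      case True
      then have "poly_fun n (d - l * m - m) (torus_ops m (Suc l) k f)"
        unfolding eq using * assms by (intro poly_fun_uminus poly_fun_hom_part_base) auto
      moreover have "Suc l * m \<le> d" "d - l * m - m = d - Suc l * m" using True * by auto
      ultimately show ?thesis by simp
    next
      case False
      then have "hom_part m (torus_ops m l k f) x (k l) = 0" for x
        using * assms by (intro hom_part_beyond_degree[of n "d - l * m"]) auto
      then show ?thesis unfolding eq by simp
    qed
  qed
qed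

text \<open>
  The sum of \<open>f (x + c\<^sub>0 k\<^sub>0 + ... + v z)\<close> over all non-zero \<open>c\<^sub>0, ..., c\<^bsub>l-1\<^esub>\<close>, where
  \<open>v = u / (c\<^sub>0 \<cdots> c\<^bsub>l-1\<^esub>)\<close> makes the product of all coefficients equal to \<open>u\<close>. The last coefficient is
  singled out so that \<open>u = 0\<close> needs no separate treatment.
\<close>

primrec torus_sum :: "nat \<Rightarrow> (nat \<Rightarrow> 'p::prime_card point) \<Rightarrow> 'p point \<Rightarrow> 'p mod_ring \<Rightarrow>
    ('p point \<Rightarrow> 'p mod_ring) \<Rightarrow> 'p point \<Rightarrow> 'p mod_ring"
  where "torus_sum 0 k z u f x = f (shift x u z)"
  | "torus_sum (Suc l) k z u f x = (\<Sum>c\<in>UNIV - {0}. torus_sum l k z (u / c) f (shift x c (k l)))"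

text \<open>
  Expanding along \<open>z\<close> produces powers of \<open>u\<close> divided by powers of the other coefficients, and the
  summation over the latter is \<open>torus_op\<close>.
\<close>

lemma torus_sum_expand:
  fixes f :: "'p::prime_card point \<Rightarrow> 'p mod_ring"
  assumes "poly_fun n d f" "d < CARD('p)"
  shows "torus_sum l k z u f x = torus_ops 0 l k f x +
    (\<Sum>m=1..CARD('p) - 1. u ^ m * torus_ops m l k (\<lambda>x. hom_part m f x z) x)"
proof (induction l arbitrary: u x)
  case 0
  have "poly_fun n (CARD('p) - 1) f" by (rule poly_fun_mono[OF assms(1)]) (use assms(2) in simp)
  then show ?case
    using poly_fun_expand[of n "CARD('p) - 1" f x u z] by simp
next
  case (Suc l)
  let ?t = "\<lambda>m. torus_ops m l k (\<lambda>x. hom_part m f x z)"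
  let ?U = "UNIV - {0 :: 'p mod_ring}" and ?M = "{1..CARD('p) - 1}"
  have "torus_sum (Suc l) k z u f x = (\<Sum>c\<in>?U. torus_ops 0 l k f (shift x c (k l)) +
      (\<Sum>m\<in>?M. (u / c) ^ m * ?t m (shift x c (k l))))"
    using Suc by simp
  also have "\<dots> = (\<Sum>c\<in>?U. torus_ops 0 l k f (shift x c (k l))) +
      (\<Sum>m\<in>?M. \<Sum>c\<in>?U. (u / c) ^ m * ?t m (shift x c (k l)))"
    unfolding sum.distrib by (subst (2) sum.swap) simp
  also have "\<dots> = torus_ops 0 (Suc l) k f x + (\<Sum>m\<in>?M. u ^ m * torus_ops m (Suc l) k (\<lambda>x. hom_part m f x z) x)"
    by (simp add: torus_op_def sum_distrib_left divide_inverse power_mult_distrib mult.assoc)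
  finally show ?case .
qed

lemma torus_sum_eq_0:
  assumes "\<And>c v. (\<Prod>i<l. c i) * v = u \<Longrightarrow> f (shift (shift x 1 (lincomb l c k)) v z) = 0"
  shows "torus_sum l k z u f x = 0"
  using assms
proof (induction l arbitrary: u x)
  case 0
  then show ?case by simp
next
  case (Suc l)
  have "torus_sum l k z (u / a) f (shift x a (k l)) = 0" if "a \<noteq> 0" for a
  proof (rule Suc.IH)
    fix c v assume cv: "(\<Prod>i<l. c i) * v = u / a"
    have "(\<Prod>i<Suc l. (c(l := a)) i) * v = u"
      using cv that by (simp add: field_simps)
    then have "f (shift (shift x 1 (lincomb (Suc l) (c(l := a)) k)) v z) = 0"
      by (rule Suc.prems)
    moreover have "lincomb (Suc l) (c(l := a)) k = shift (lincomb l c k) a (k l)"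
      unfolding lincomb_Suc by (simp add: lincomb_def)
    moreover have "shift x 1 (shift (lincomb l c k) a (k l)) = shift (shift x a (k l)) 1 (lincomb l c k)"
      by (auto simp: shift_def algebra_simps)
    ultimately show "f (shift (shift (shift x a (k l)) 1 (lincomb l c k)) v z) = 0"
      by (simp only:)
  qed
  then show ?case by simp
qed

text \<open>
  The torus sum of \<open>Q\<close> with \<open>u = - s\<close> vanishes. Its term of degree \<open>0\<close> in \<open>u\<close> is \<open>Q x\<close> up to sign, and
  in the coefficient of \<open>u ^ i\<close> a homogeneous part of degree \<open>i\<close> has been taken in each of the
  \<open>l + 1\<close> directions, which lowers the degree by \<open>(l + 1) i\<close>.
\<close>

lemma division:
  fixes Q :: "'p::prime_card point \<Rightarrow> 'p mod_ring"
  assumes Q: "poly_fun n d Q" "d < CARD('p)" "determined n g m Q"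
    and axes: "\<And>j c. l \<noteq> 0 \<Longrightarrow> j \<le> l \<Longrightarrow> Q (shift origin c (k j)) = 0"
  shows "\<exists>Y. (\<forall>i\<in>{1..CARD('p) - 1}. determined n g (CARD('p) ^ Suc l * m) (Y i) \<and>
      ((\<forall>x. Y i x = 0) \<or> Suc l * i \<le> d \<and> poly_fun n (d - Suc l * i) (Y i))) \<and>
    (\<forall>x s. (\<forall>c. (\<Prod>j<Suc l. c j) = - s \<longrightarrow> Q (shift x 1 (lincomb (Suc l) c k)) = 0) \<longrightarrow>
      Q x = (\<Sum>i=1..CARD('p) - 1. s ^ i * Y i x))"
proof -
  let ?p = "CARD('p)"
  define t where "t i = torus_ops i l k (\<lambda>x. hom_part i Q x (k l))" for i
  \<comment> \<open>the signs come from \<open>lead\<close> below and from \<open>u = - s\<close>\<close>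
  define Y where "Y i = (\<lambda>x. (- ((- 1) ^ l * (- 1) ^ i)) * t i x)" for i
  have t_det: "determined n g (?p ^ Suc l * m) (t i)" for i
    using determined_torus_ops[OF determined_hom_part[OF Q(3)], of l i k i "k l"]
    by (simp add: t_def mult_ac)
  have t_poly_fun: "(\<forall>x. t i x = 0) \<or> Suc l * i \<le> d \<and> poly_fun n (d - Suc l * i) (t i)"
    if i: "i \<in> {1..?p - 1}" for i
  proof (cases "i \<le> d")
    case False
    then have "hom_part i Q x (k l) = 0" for x
      using Q i by (intro hom_part_beyond_degree[of n d]) auto
    then have "\<forall>x. t i x = 0" unfolding t_def by (intro allI torus_ops_of_zero)
    then show ?thesis by blast
  next
    case True
    then have c: "poly_fun n (d - i) (\<lambda>x. hom_part i Q x (k l))"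
      using Q i by (intro poly_fun_hom_part_base) auto
    consider "l = 0" | "l \<noteq> 0" "i = ?p - 1" | "i < ?p - 1" using i by fastforce
    then show ?thesis
    proof cases
      case 1
      then show ?thesis using c True by (simp add: t_def)
    next
      \<comment> \<open>here \<open>inverse c ^ i = 1\<close>, so \<open>torus_op\<close> takes no homogeneous part, but the first one is already zero\<close>
      case 2
      then have "hom_part i Q x (k l) = 0" for x
        using torus_op_0_eq_uminus(2)[OF Q(1,2) axes] by simp
      then have "\<forall>x. t i x = 0" unfolding t_def by (intro allI torus_ops_of_zero)
    then show ?thesis by blast
    next
      case 3
      then have "(\<forall>x. t i x = 0) \<or> l * i \<le> d - i \<and> poly_fun n (d - i - l * i) (t i)"
        unfolding t_def using i Q(2) by (intro poly_fun_torus_ops c) auto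
      moreover have "d - i - l * i = d - Suc l * i" by simp
      moreover have "l * i \<le> d - i \<longleftrightarrow> Suc l * i \<le> d" using True by auto
      ultimately show ?thesis by metis
    qed
  qed
  have lead: "torus_ops 0 j k Q x = (- 1) ^ j * Q x" if "j \<le> l" for j x
    using that
  proof (induction j arbitrary: x)
    case (Suc j)
    have "torus_ops 0 (Suc j) k Q x = (- 1) ^ j * torus_op 0 (k j) Q x"
      using Suc by (simp add: torus_op_def sum_distrib_left)
    then show ?case
      using torus_op_0_eq_uminus(1)[OF Q(1,2), of "k j"] axes[of j] Suc.prems by simp
  qed simp
  have "Q x = (\<Sum>i=1..?p - 1. s ^ i * Y i x)"
    if zero: "\<And>c. (\<Prod>j<Suc l. c j) = - s \<Longrightarrow> Q (shift x 1 (lincomb (Suc l) c k)) = 0" for x s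
  proof -
    have "torus_sum l k (k l) (- s) Q x = 0"
    proof (rule torus_sum_eq_0)
      fix c v assume "(\<Prod>i<l. c i) * v = - s"
      then have "(\<Prod>j<Suc l. (c(l := v)) j) = - s" by simp
      moreover have "lincomb (Suc l) (c(l := v)) k = shift (lincomb l c k) v (k l)"
        unfolding lincomb_Suc by (simp add: lincomb_def)
      moreover have "shift (shift x 1 (lincomb l c k)) v (k l) = shift x 1 (shift (lincomb l c k) v (k l))"
        by (auto simp: shift_def algebra_simps)
      ultimately show "Q (shift (shift x 1 (lincomb l c k)) v (k l)) = 0"
        using zero[of "c(l := v)"] by (simp only:)
    qed
    then have "(- 1) ^ l * Q x = - (\<Sum>i=1..?p - 1. (- s) ^ i * t i x)"
      unfolding torus_sum_expand[OF Q(1,2)] lead[OF order_refl] t_def by (simp add: eq_neg_iff_add_eq_0)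
    then have "(- 1) ^ l * ((- 1) ^ l * Q x) = (\<Sum>i=1..?p - 1. s ^ i * Y i x)"
      by (simp add: Y_def sum_distrib_left power_minus[of s] algebra_simps sum_negf)
    then show ?thesis by (simp flip: mult.assoc power_mult_distrib)
  qed
  moreover have "determined n g (?p ^ Suc l * m) (Y i)" for i
    unfolding Y_def by (rule determined_map[OF t_det])
  moreover have "(\<forall>x. Y i x = 0) \<or> Suc l * i \<le> d \<and> poly_fun n (d - Suc l * i) (Y i)"
    if "i \<in> {1..?p - 1}" for i
    using t_poly_fun[OF that] poly_fun_cmult[of n "d - Suc l * i" "t i" "- ((- 1) ^ l * (- 1) ^ i)"]
    unfolding Y_def by (metis mult_zero_right)
  ultimately show ?thesis by (intro exI[of _ Y]) blast
qed

section \<open>Sums of products of polynomials of low degree\<close>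

text \<open>
  The numbers paired with the factors are degree bounds. They are carried along because the products
  must not exceed the degree \<open>d\<close> in the formal sense, also where cancellation makes the degree of
  the sum smaller. One number \<open>r\<close> bounds both the number of products and their lengths.
\<close>

definition decomposable :: "nat \<Rightarrow> nat \<Rightarrow> nat \<Rightarrow> nat \<Rightarrow> ('p::prime_card point \<Rightarrow> 'p mod_ring) \<Rightarrow> bool"
  where "decomposable n g d r f \<longleftrightarrow> (\<exists>Ts. length Ts \<le> r \<and>
    (\<forall>T\<in>set Ts. length T \<le> r \<and> sum_list (map snd T) \<le> d \<and>
      (\<forall>(a, h)\<in>set T. h \<le> g \<and> poly_fun n h a)) \<and>
    (\<forall>x. f x = (\<Sum>T\<leftarrow>Ts. \<Prod>(a, h)\<leftarrow>T. a x)))"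

lemma decomposable_zero: "(\<And>x. f x = 0) \<Longrightarrow> decomposable n g d r f"
  unfolding decomposable_def by (intro exI[of _ "[]"]) simp

lemma decomposable_mono: "decomposable n g d r f \<Longrightarrow> d \<le> d' \<Longrightarrow> r \<le> r' \<Longrightarrow> decomposable n g d' r' f"
  unfolding decomposable_def by (meson order_trans)

lemma decomposable_single: "poly_fun n d f \<Longrightarrow> d \<le> g \<Longrightarrow> decomposable n g d 1 f"
  unfolding decomposable_def by (intro exI[of _ "[[(f, d)]]"]) simp

lemma decomposableE:
  assumes "decomposable n g d r f"
  obtains Ts where "length Ts \<le> r"
    "\<And>T. T \<in> set Ts \<Longrightarrow> length T \<le> r \<and> sum_list (map snd T) \<le> d \<and> (\<forall>(a, h)\<in>set T. h \<le> g \<and> poly_fun n h a)"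
    "\<And>x. f x = (\<Sum>T\<leftarrow>Ts. \<Prod>(a, h)\<leftarrow>T. a x)"
  using assms unfolding decomposable_def by auto

lemma decomposableI:
  assumes "length Ts \<le> r"
    "\<And>T. T \<in> set Ts \<Longrightarrow> length T \<le> r \<and> sum_list (map snd T) \<le> d \<and> (\<forall>(a, h)\<in>set T. h \<le> g \<and> poly_fun n h a)"
    "\<And>x. f x = (\<Sum>T\<leftarrow>Ts. \<Prod>(a, h)\<leftarrow>T. a x)"
  shows "decomposable n g d r f"
  using assms unfolding decomposable_def by blast

lemma decomposable_add:
  assumes "decomposable n g d r f" "decomposable n g d r' f'"
  shows "decomposable n g d (r + r') (\<lambda>x. f x + f' x)"
proof -
  obtain Ts where Ts: "length Ts \<le> r"
    "\<And>T. T \<in> set Ts \<Longrightarrow> length T \<le> r \<and> sum_list (map snd T) \<le> d \<and> (\<forall>(a, h)\<in>set T. h \<le> g \<and> poly_fun n h a)"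
    "\<And>x. f x = (\<Sum>T\<leftarrow>Ts. \<Prod>(a, h)\<leftarrow>T. a x)"
    using assms(1) by (rule decomposableE) blast
  obtain Ts' where Ts': "length Ts' \<le> r'"
    "\<And>T. T \<in> set Ts' \<Longrightarrow> length T \<le> r' \<and> sum_list (map snd T) \<le> d \<and> (\<forall>(a, h)\<in>set T. h \<le> g \<and> poly_fun n h a)"
    "\<And>x. f' x = (\<Sum>T\<leftarrow>Ts'. \<Prod>(a, h)\<leftarrow>T. a x)"
    using assms(2) by (rule decomposableE) blast
  show ?thesis
  proof (rule decomposableI)
    show "length (Ts @ Ts') \<le> r + r'" using Ts(1) Ts'(1) by simp
    show "length T \<le> r + r' \<and> sum_list (map snd T) \<le> d \<and> (\<forall>(a, h)\<in>set T. h \<le> g \<and> poly_fun n h a)"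
      if "T \<in> set (Ts @ Ts')" for T
      using that Ts(2)[of T] Ts'(2)[of T] by (auto simp del: split_paired_All split_paired_Ex)
    show "f x + f' x = (\<Sum>T\<leftarrow>Ts @ Ts'. \<Prod>(a, h)\<leftarrow>T. a x)" for x
      by (simp add: Ts(3) Ts'(3))
  qed
qed

lemma decomposable_sum:
  assumes "finite I" "\<And>i. i \<in> I \<Longrightarrow> decomposable n g d r (f i)"
  shows "decomposable n g d (card I * r) (\<lambda>x. \<Sum>i\<in>I. f i x)"
  using assms
proof (induction I rule: finite_induct)
  case (insert i I)
  have "decomposable n g d (r + card I * r) (\<lambda>x. f i x + (\<Sum>i\<in>I. f i x))"
    using insert by (intro decomposable_add) auto
  then show ?case using insert.hyps by simp
qed (simp add: decomposable_zero)

lemma decomposable_mult: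
  assumes "poly_fun n h b" "h \<le> g" "decomposable n g d r f"
  shows "decomposable n g (h + d) (Suc r) (\<lambda>x. b x * f x)"
proof -
  obtain Ts where Ts: "length Ts \<le> r"
    "\<And>T. T \<in> set Ts \<Longrightarrow> length T \<le> r \<and> sum_list (map snd T) \<le> d \<and> (\<forall>(a, h)\<in>set T. h \<le> g \<and> poly_fun n h a)"
    "\<And>x. f x = (\<Sum>T\<leftarrow>Ts. \<Prod>(a, h)\<leftarrow>T. a x)"
    using assms(3) by (rule decomposableE) blast
  show ?thesis
  proof (rule decomposableI)
    show "length (map ((#) (b, h)) Ts) \<le> Suc r" using Ts(1) by simp
    show "b x * f x = (\<Sum>T\<leftarrow>map ((#) (b, h)) Ts. \<Prod>(a, h)\<leftarrow>T. a x)" for x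
      unfolding Ts(3) by (induction Ts) (simp_all add: distrib_left)
    fix T assume "T \<in> set (map ((#) (b, h)) Ts)"
    then obtain T' where "T' \<in> set Ts" "T = (b, h) # T'" by auto
    then show "length T \<le> Suc r \<and> sum_list (map snd T) \<le> h + d \<and> (\<forall>(a, h)\<in>set T. h \<le> g \<and> poly_fun n h a)"
      using Ts(2)[of T'] assms(1,2) by simp
  qed
qed

lemma decomposable_mult_power:
  assumes "poly_fun n h b" "h \<le> g" "decomposable n g d r f"
  shows "decomposable n g (h * i + d) (i + r) (\<lambda>x. b x ^ i * f x)"
proof (induction i)
  case (Suc i)
  have "decomposable n g (h + (h * i + d)) (Suc (i + r)) (\<lambda>x. b x * (b x ^ i * f x))"
    by (rule decomposable_mult[OF assms(1,2) Suc])
  then show ?case by (simp add: mult.assoc add.assoc)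
qed (simp add: assms)

lemma poly_fun_decomposable:
  fixes f :: "'p::prime_card point \<Rightarrow> 'p mod_ring"
  shows "decomposable n g d r f \<Longrightarrow> poly_fun n d f"
proof -
  have factor: "poly_fun n (sum_list (map snd T)) (\<lambda>x. \<Prod>(a, h)\<leftarrow>T. a x)"
    if "\<forall>(a, h)\<in>set T. poly_fun n h a" for T :: "(('p point \<Rightarrow> 'p mod_ring) \<times> nat) list"
    using that by (induction T) (auto intro: poly_fun.intros)
  assume "decomposable n g d r f"
  then obtain Ts where Ts:
    "\<And>T. T \<in> set Ts \<Longrightarrow> length T \<le> r \<and> sum_list (map snd T) \<le> d \<and> (\<forall>(a, h)\<in>set T. h \<le> g \<and> poly_fun n h a)"
    "\<And>x. f x = (\<Sum>T\<leftarrow>Ts. \<Prod>(a, h)\<leftarrow>T. a x)"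
    by (rule decomposableE) blast
  have product: "poly_fun n d (\<lambda>x. \<Prod>(a, h)\<leftarrow>T. a x)" if "T \<in> set Ts" for T
    by (rule poly_fun_mono[OF factor]) (use Ts(1)[OF that] in auto)
  have "set Us \<subseteq> set Ts \<Longrightarrow> poly_fun n d (\<lambda>x. \<Sum>T\<leftarrow>Us. \<Prod>(a, h)\<leftarrow>T. a x)" for Us
    by (induction Us) (auto intro: poly_fun.const poly_fun.add product)
  then have "poly_fun n d (\<lambda>x. \<Sum>T\<leftarrow>Ts. \<Prod>(a, h)\<leftarrow>T. a x)" by blast
  moreover have "f = (\<lambda>x. \<Sum>T\<leftarrow>Ts. \<Prod>(a, h)\<leftarrow>T. a x)" using Ts(2) by blast
  ultimately show "poly_fun n d f" by simp
qed

text \<open>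
  With \<open>s = \<beta> x - \<beta> origin\<close>, the points over which the torus sum runs lie in the level set on which \<open>Q\<close>
  vanishes: on the level set in the conclusion, the increment along the product system is the
  same at \<open>x\<close> as at the origin.
\<close>

lemma elimination_step:
  fixes Q \<beta> :: "'p::prime_card point \<Rightarrow> 'p mod_ring"
  assumes Q: "poly_fun n d Q" "d < CARD('p)" "determined n g m Q"
    and U: "\<forall>b\<in>insert \<beta> T. poly_fun n h b" and h: "1 \<le> h" "h < CARD('p)"
    and zero: "\<And>x. agree (insert \<beta> T) x origin \<Longrightarrow> Q x = 0"
    and k: "\<And>c. agree T (lincomb h c k) origin" "\<And>c. \<beta> (lincomb h c k) = \<beta> origin + (\<Prod>j<h. c j)"
  shows "\<exists>Y. (\<forall>i\<in>{1..CARD('p) - 1}. determined n g (CARD('p) ^ h * m) (Y i) \<and>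
      ((\<forall>x. Y i x = 0) \<or> h * i \<le> d \<and> poly_fun n (d - h * i) (Y i))) \<and>
    (\<forall>x. agree (T \<union> lower_parts h (range (\<lambda>c. lincomb h c k)) (insert \<beta> T)) x origin \<longrightarrow>
      Q x = (\<Sum>i=1..CARD('p) - 1. (\<beta> x - \<beta> origin) ^ i * Y i x))"
proof -
  let ?p = "CARD('p)" and ?L = "lower_parts h (range (\<lambda>c. lincomb h c k)) (insert \<beta> T)"
  obtain l where l: "h = Suc l" using h(1) by (cases h) auto
  have on_kernel: "Q y = 0" if "\<And>b. b \<in> T \<Longrightarrow> b y = b origin" "\<beta> y = \<beta> origin" for y
    using that by (intro zero) (auto simp: agree_def)
  have axes: "Q (shift origin c (k j)) = 0" if "l \<noteq> 0" "j \<le> l" for j c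
  proof -
    \<comment> \<open>a multiple of a single vector of the system: the product of its at least two coefficients is zero\<close>
    define e where "e i = (if i = j then c else 0)" for i
    define i where "i = (if j = 0 then 1 else 0 :: nat)"
    have "i < h" "i \<noteq> j"
      using that(1) by (auto simp: l i_def)
    then have "(\<Prod>i<h. e i) = 0"
      by (intro prod_zero) (auto simp: e_def)
    moreover have "lincomb h e k = shift origin c (k j)"
      using that by (auto simp: lincomb_def shift_def e_def l if_distrib if_distribR cong: if_cong)
    ultimately show ?thesis
      using k(1)[of e] k(2)[of e] by (intro on_kernel) (auto simp: agree_def)
  qed
  have "\<exists>Y. (\<forall>i\<in>{1..?p - 1}. determined n g (?p ^ h * m) (Y i) \<and>
      ((\<forall>x. Y i x = 0) \<or> h * i \<le> d \<and> poly_fun n (d - h * i) (Y i))) \<and>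
    (\<forall>x s. (\<forall>c. (\<Prod>j<h. c j) = - s \<longrightarrow> Q (shift x 1 (lincomb h c k)) = 0) \<longrightarrow>
      Q x = (\<Sum>i=1..?p - 1. s ^ i * Y i x))"
    unfolding l by (rule division[OF Q axes])
  then obtain Y where Y: "\<forall>i\<in>{1..?p - 1}. determined n g (?p ^ h * m) (Y i) \<and>
      ((\<forall>x. Y i x = 0) \<or> h * i \<le> d \<and> poly_fun n (d - h * i) (Y i))"
    and div: "\<forall>x s. (\<forall>c. (\<Prod>j<h. c j) = - s \<longrightarrow> Q (shift x 1 (lincomb h c k)) = 0) \<longrightarrow>
      Q x = (\<Sum>i=1..?p - 1. s ^ i * Y i x)"
    by (elim exE conjE) (rule that)
  have "Q x = (\<Sum>i=1..?p - 1. (\<beta> x - \<beta> origin) ^ i * Y i x)"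
    if x: "agree (T \<union> ?L) x origin" for x
  proof (rule div[rule_format])
    fix c assume c: "(\<Prod>j<h. c j) = - (\<beta> x - \<beta> origin)"
    have "lincomb h (\<lambda>_. 0) k = origin" by (simp add: lincomb_def)
    then have "origin \<in> range (\<lambda>c. lincomb h c k)" by (metis rangeI)
    then have step: "b (shift x 1 (lincomb h c k)) = b (lincomb h c k) + (b x - b origin)" if "b \<in> insert \<beta> T" for b
      using additive_of_agree_lower_parts[of n h b "insert \<beta> T" "lincomb h c k" "range (\<lambda>c. lincomb h c k)" origin x 1]
        U h x that by (simp add: agree_Un shift_1_commute)
    show "Q (shift x 1 (lincomb h c k)) = 0"
    proof (rule on_kernel)
      fix b assume "b \<in> T"
      then have "b (lincomb h c k) = b origin" "b x = b origin"
        using k(1)[of c] x unfolding agree_def by blast+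
      then show "b (shift x 1 (lincomb h c k)) = b origin"
        using step[of b] \<open>b \<in> T\<close> by simp
    next
      show "\<beta> (shift x 1 (lincomb h c k)) = \<beta> origin"
        using step[of \<beta>] k(2)[of c] c by simp
    qed
  qed
  then show ?thesis using Y by (intro exI[of _ Y]) simp
qed

section \<open>Eliminating the polynomials that define a level set\<close>

text \<open>
  The set \<open>A\<close> collects the polynomials of the current top degree \<open>h\<close>, of which there are at most \<open>N\<close>,
  and \<open>B\<close> those of lower degree. An elimination makes \<open>B\<close> larger but \<open>A\<close> smaller, so the induction is
  lexicographic in \<open>h\<close> and \<open>N\<close>, for all \<open>M\<close> and \<open>m\<close> at once.
\<close>

definition elim_bound :: "'p::prime_card itself \<Rightarrow> nat \<Rightarrow> nat \<Rightarrow> nat \<Rightarrow> nat \<Rightarrow> nat \<Rightarrow> nat \<Rightarrow> nat \<Rightarrow> bool"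
  where "elim_bound TYPE('p) g d h N m M r \<longleftrightarrow> (\<forall>n (Q :: 'p point \<Rightarrow> 'p mod_ring) A B.
    poly_fun n d Q \<longrightarrow> determined n g m Q \<longrightarrow> finite A \<longrightarrow> card A \<le> N \<longrightarrow> (\<forall>a\<in>A. poly_fun n h a) \<longrightarrow>
    finite B \<longrightarrow> card B \<le> M \<longrightarrow> (\<forall>b\<in>B. poly_fun n (h - 1) b) \<longrightarrow>
    (\<forall>x. agree (A \<union> B) x origin \<longrightarrow> Q x = 0) \<longrightarrow> decomposable n g d r Q)"

lemma elim_boundI:
  assumes "\<And>n (Q :: 'p::prime_card point \<Rightarrow> 'p mod_ring) A B.
    poly_fun n d Q \<Longrightarrow> determined n g m Q \<Longrightarrow> finite A \<Longrightarrow> card A \<le> N \<Longrightarrow> \<forall>a\<in>A. poly_fun n h a \<Longrightarrow>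
    finite B \<Longrightarrow> card B \<le> M \<Longrightarrow> \<forall>b\<in>B. poly_fun n (h - 1) b \<Longrightarrow>
    (\<And>x. agree (A \<union> B) x origin \<Longrightarrow> Q x = 0) \<Longrightarrow> decomposable n g d r Q"
  shows "elim_bound TYPE('p) g d h N m M r"
  unfolding elim_bound_def by (intro allI impI, rule assms) auto

lemma elim_boundD:
  assumes "elim_bound TYPE('p::prime_card) g d h N m M r"
    "poly_fun n d (Q :: 'p point \<Rightarrow> 'p mod_ring)" "determined n g m Q"
    "finite A" "card A \<le> N" "\<forall>a\<in>A. poly_fun n h a"
    "finite B" "card B \<le> M" "\<forall>b\<in>B. poly_fun n (h - 1) b"
    "\<And>x. agree (A \<union> B) x origin \<Longrightarrow> Q x = 0"
  shows "decomposable n g d r Q"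
proof -
  note * = assms(1)[unfolded elim_bound_def, THEN spec[of _ n], THEN spec[of _ Q],
    THEN spec[of _ A], THEN spec[of _ B]]
  show ?thesis using * assms(2-10) by blast
qed

definition eliminable :: "'p::prime_card itself \<Rightarrow> nat \<Rightarrow> nat \<Rightarrow> nat \<Rightarrow> nat \<Rightarrow> bool"
  where "eliminable TYPE('p) g d h N \<longleftrightarrow> (\<forall>m M. \<exists>r. elim_bound TYPE('p) g d h N m M r)"

lemma eliminable_zero: "eliminable TYPE('p::prime_card) g d 0 N"
proof -
  have "elim_bound TYPE('p) g d 0 N m M 0" for m M
  proof (rule elim_boundI)
    fix n A B and Q :: "'p point \<Rightarrow> 'p mod_ring"
    assume A: "\<forall>a\<in>A. poly_fun n 0 a" and B: "\<forall>b\<in>B. poly_fun n (0 - 1) b"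
      and zero: "\<And>x. agree (A \<union> B) x origin \<Longrightarrow> Q x = 0"
    have "agree (A \<union> B) x origin" for x
      unfolding agree_def
    proof
      fix b assume "b \<in> A \<union> B"
      then have "poly_fun n 0 b" using A B by auto
      then show "b x = b origin" by (rule poly_fun_degree_0)
    qed
    then show "decomposable n g d 0 Q" by (intro decomposable_zero zero)
  qed
  then show ?thesis unfolding eliminable_def by blast
qed

text \<open>
  One polynomial \<open>\<beta>\<close> of degree \<open>h\<close> is removed, either because it is constant on the level set of the others
  and of \<open>C\<close> further polynomials of lower degree, or by subtracting the sum \<open>S\<close> of the multiples of
  powers of \<open>\<beta> - \<beta> origin\<close>, whose cofactors are decomposable by the induction hypothesis \<open>IH\<close>.
\<close>

lemma eliminable_Suc:
  assumes IH: "\<And>d' m. d' < d \<Longrightarrow> \<exists>r. \<forall>n (Q :: 'p::prime_card point \<Rightarrow> 'p mod_ring).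
      poly_fun n d' Q \<and> determined n g m Q \<longrightarrow> decomposable n g d' r Q"
    and elim: "eliminable TYPE('p) g d h N"
    and h: "1 \<le> h" "h \<le> g" "h < CARD('p)" and d: "d < CARD('p)"
  shows "eliminable TYPE('p) g d h (Suc N)"
  unfolding eliminable_def
proof (intro allI)
  fix m M :: nat
  let ?p = "CARD('p)"
  obtain C where C: "\<forall>n T (\<beta> :: 'p point \<Rightarrow> 'p mod_ring).
      (\<forall>b\<in>T. poly_fun n h b) \<and> finite T \<and> card T \<le> N + M \<and> poly_fun n h \<beta> \<longrightarrow>
      (\<exists>B. finite B \<and> card B \<le> C \<and> (\<forall>b\<in>B. poly_fun n (h - 1) b) \<and>
        (\<forall>x. agree (T \<union> B) x origin \<longrightarrow> \<beta> x = \<beta> origin)) \<or>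
      (\<exists>k. \<forall>c. agree T (lincomb h c k) origin \<and> \<beta> (lincomb h c k) = \<beta> origin + (\<Prod>j<h. c j))"
    using constant_or_product_system[OF h(1,3), of "N + M"] by (rule exE)
  define M2 where "M2 = M + Suc (N + M) * (?p ^ h * h)"
  define m2 where "m2 = m + ?p * (1 + ?p ^ h * m)"
  obtain r1 where r1: "elim_bound TYPE('p) g d h N m (M + C) r1"
    using elim unfolding eliminable_def by blast
  obtain r2 where r2: "elim_bound TYPE('p) g d h N m2 M2 r2"
    using elim unfolding eliminable_def by blast
  obtain rr where rr: "\<And>d' n (Q :: 'p point \<Rightarrow> 'p mod_ring). d' < d \<Longrightarrow> poly_fun n d' Q \<Longrightarrow>
      determined n g (?p ^ h * m) Q \<Longrightarrow> decomposable n g d' (rr d') Q"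
    using IH[of _ "?p ^ h * m"] by metis
  define r3 where "r3 = (\<Sum>d'<d. rr d')"
  have r3: "rr d' \<le> r3" if "d' < d" for d'
    unfolding r3_def using that by (intro member_le_sum) auto
  have main: "decomposable n g d (r1 + r2 + ?p * (?p + r3)) Q"
    if Q: "poly_fun n d Q" "determined n g m Q"
      and A: "finite A" "card A \<le> Suc N" "\<forall>a\<in>A. poly_fun n h a"
      and B: "finite B" "card B \<le> M" "\<forall>b\<in>B. poly_fun n (h - 1) b"
      and zero: "\<And>x. agree (A \<union> B) x origin \<Longrightarrow> Q x = 0"
    for n A B and Q :: "'p point \<Rightarrow> 'p mod_ring"
  proof (cases "card A \<le> N")
    case True
    then have "decomposable n g d r1 Q" using Q A B zero by (intro elim_boundD[OF r1, of n Q A B]) auto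
    then show ?thesis by (rule decomposable_mono) auto
  next
    case False
    then obtain \<beta> where \<beta>: "\<beta> \<in> A" using A by fastforce
    define A' where "A' = A - {\<beta>}"
    define T where "T = A' \<union> B"
    have A': "finite A'" "card A' \<le> N" "\<forall>a\<in>A'. poly_fun n h a"
      using A \<beta> by (auto simp: A'_def)
    have T: "\<forall>b\<in>T. poly_fun n h b" "finite T" "card T \<le> N + M"
      using A' B poly_fun_mono[of n "h - 1" _ h] card_Un_le[of A' B] by (auto simp: T_def)
    have \<beta>': "poly_fun n h \<beta>" using A \<beta> by blast
    have AB: "A \<union> B = insert \<beta> T" using \<beta> by (auto simp: T_def A'_def)
    from C[rule_format, OF conjI[OF T(1) conjI[OF T(2) conjI[OF T(3) \<beta>']]]] show ?thesis
    proof
      assume "\<exists>B. finite B \<and> card B \<le> C \<and> (\<forall>b\<in>B. poly_fun n (h - 1) b) \<and>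
        (\<forall>x. agree (T \<union> B) x origin \<longrightarrow> \<beta> x = \<beta> origin)"
      then obtain D where D: "finite D" "card D \<le> C" "\<forall>b\<in>D. poly_fun n (h - 1) b"
        "\<And>x. agree (T \<union> D) x origin \<Longrightarrow> \<beta> x = \<beta> origin" by blast
      have "decomposable n g d r1 Q"
      proof (rule elim_boundD[OF r1, of n Q A' "B \<union> D"])
        show "card (B \<union> D) \<le> M + C" using card_Un_le[of B D] B(2) D(2) by linarith
        fix x assume x: "agree (A' \<union> (B \<union> D)) x origin"
        then have "\<beta> x = \<beta> origin" by (intro D(4)) (simp add: T_def Un_assoc)
        then have "agree (A \<union> B) x origin"
          using x unfolding AB agree_def T_def by blast
        then show "Q x = 0" by (rule zero)
      qed (use Q A' B D in auto)
      then show ?thesis by (rule decomposable_mono) auto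
    next
      assume "\<exists>k. \<forall>c. agree T (lincomb h c k) origin \<and> \<beta> (lincomb h c k) = \<beta> origin + (\<Prod>j<h. c j)"
      then obtain k where k: "\<And>c. agree T (lincomb h c k) origin"
        "\<And>c. \<beta> (lincomb h c k) = \<beta> origin + (\<Prod>j<h. c j)" by blast
      have U: "\<forall>b\<in>insert \<beta> T. poly_fun n h b" "finite (insert \<beta> T)" "card (insert \<beta> T) \<le> Suc (N + M)"
        using T \<beta>' by (auto simp: card_insert_if)
      define L where "L = lower_parts h (range (\<lambda>c. lincomb h c k)) (insert \<beta> T)"
      have "card L \<le> card (insert \<beta> T) * (card (range (\<lambda>c. lincomb h c k)) * h)"
        unfolding L_def by (rule card_lower_parts[OF U(2) card_lincomb_range(1)])
      also have "\<dots> \<le> Suc (N + M) * (?p ^ h * h)"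
        by (intro mult_le_mono U(3) card_lincomb_range(2) order_refl)
      finally have L: "finite L" "card L \<le> Suc (N + M) * (?p ^ h * h)" "\<forall>b\<in>L. poly_fun n (h - 1) b"
        unfolding L_def using card_lower_parts(1)[OF U(2) card_lincomb_range(1)] poly_fun_lower_parts[OF U(1) h(3)]
        by blast+
      have "\<exists>Y. (\<forall>i\<in>{1..?p - 1}. determined n g (?p ^ h * m) (Y i) \<and>
          ((\<forall>x. Y i x = 0) \<or> h * i \<le> d \<and> poly_fun n (d - h * i) (Y i))) \<and>
        (\<forall>x. agree (T \<union> L) x origin \<longrightarrow> Q x = (\<Sum>i=1..?p - 1. (\<beta> x - \<beta> origin) ^ i * Y i x))"
        unfolding L_def
        by (rule elimination_step[OF Q(1) d Q(2) U(1) h(1,3) _ k]) (use zero in \<open>simp add: AB\<close>)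
      then obtain Y where
        Y': "\<forall>i\<in>{1..?p - 1}. determined n g (?p ^ h * m) (Y i) \<and>
          ((\<forall>x. Y i x = 0) \<or> h * i \<le> d \<and> poly_fun n (d - h * i) (Y i))"
        and div: "\<forall>x. agree (T \<union> L) x origin \<longrightarrow>
          Q x = (\<Sum>i=1..?p - 1. (\<beta> x - \<beta> origin) ^ i * Y i x)"
        by (elim exE conjE) (rule that)
      have Y: "determined n g (?p ^ h * m) (Y i)"
          "(\<forall>x. Y i x = 0) \<or> h * i \<le> d \<and> poly_fun n (d - h * i) (Y i)" if "i \<in> {1..?p - 1}" for i
        using Y'[rule_format, OF that] by simp_all
      have b: "poly_fun n h (\<lambda>x. \<beta> x - \<beta> origin)" by (intro poly_fun_diff \<beta>' poly_fun.const)
      define S where "S x = (\<Sum>i=1..?p - 1. (\<beta> x - \<beta> origin) ^ i * Y i x)" for x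
      have summand: "decomposable n g d (?p + r3) (\<lambda>x. (\<beta> x - \<beta> origin) ^ i * Y i x)" if i: "i \<in> {1..?p - 1}" for i
        using Y(2)[OF i]
      proof
        assume "\<forall>x. Y i x = 0"
        then show ?thesis by (intro decomposable_zero) simp
      next
        assume *: "h * i \<le> d \<and> poly_fun n (d - h * i) (Y i)"
        have "0 < h * i" using h(1) i by simp
        then have less: "d - h * i < d" using * by linarith
        have "decomposable n g (h * i + (d - h * i)) (i + rr (d - h * i)) (\<lambda>x. (\<beta> x - \<beta> origin) ^ i * Y i x)"
          using * by (intro decomposable_mult_power b h(2) rr less Y(1) i) auto
        then show ?thesis by (rule decomposable_mono) (use * r3[OF less] i in auto)
      qed
      have S: "decomposable n g d (?p * (?p + r3)) S"
        unfolding S_def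
        by (rule decomposable_mono[OF decomposable_sum[OF _ summand]]) auto
      have "determined n g (1 + ?p ^ h * m) (\<lambda>x. (\<beta> x - \<beta> origin) ^ i * Y i x)"
        if "i \<in> {1..?p - 1}" for i
        using determined_map2[OF determined_poly_fun Y(1)[OF that], of \<beta> "\<lambda>u v. (u - \<beta> origin) ^ i * v"]
          poly_fun_mono[OF \<beta>' h(2)] by simp
      then have "determined n g (card {1..?p - 1} * (1 + ?p ^ h * m)) S"
        unfolding S_def by (intro determined_sum) auto
      then have "determined n g (?p * (1 + ?p ^ h * m)) S"
        by (rule determined_mono) (intro mult_le_mono1, simp)
      then have "determined n g m2 (\<lambda>x. Q x - S x)"
        unfolding m2_def by (rule determined_map2[OF Q(2)])
      moreover have "poly_fun n d (\<lambda>x. Q x - S x)"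
        by (rule poly_fun_diff[OF Q(1) poly_fun_decomposable[OF S]])
      moreover have "card (B \<union> L) \<le> M2"
        unfolding M2_def using card_Un_le[of B L] B(2) L(2) by linarith
      ultimately have "decomposable n g d r2 (\<lambda>x. Q x - S x)"
        using A' B L div unfolding T_def S_def
        by (intro elim_boundD[OF r2, of n _ A' "B \<union> L"]) (auto simp: Un_assoc)
      then have "decomposable n g d (r2 + ?p * (?p + r3)) (\<lambda>x. Q x - S x + S x)"
        using S by (rule decomposable_add)
      then have "decomposable n g d (r2 + ?p * (?p + r3)) Q" by simp
      then show ?thesis by (rule decomposable_mono) auto
    qed
  qed
  have "elim_bound TYPE('p) g d h (Suc N) m M (r1 + r2 + ?p * (?p + r3))"
    by (rule elim_boundI, rule main)
  then show "\<exists>r. elim_bound TYPE('p) g d h (Suc N) m M r" by blast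
qed

lemma eliminable_all:
  assumes IH: "\<And>d' m. d' < d \<Longrightarrow> \<exists>r. \<forall>n (Q :: 'p::prime_card point \<Rightarrow> 'p mod_ring).
      poly_fun n d' Q \<and> determined n g m Q \<longrightarrow> decomposable n g d' r Q"
    and d: "d < CARD('p)"
  shows "h \<le> g \<Longrightarrow> h < CARD('p) \<Longrightarrow> eliminable TYPE('p) g d h N"
proof (induction h arbitrary: N)
  case 0
  show ?case by (rule eliminable_zero)
next
  case (Suc h N)
  have base: "eliminable TYPE('p) g d (Suc h) 0"
    unfolding eliminable_def
  proof (intro allI)
    fix m M
    have "eliminable TYPE('p) g d h M" using Suc by simp
    then obtain r where r: "elim_bound TYPE('p) g d h M m 0 r"
      unfolding eliminable_def by blast
    have "elim_bound TYPE('p) g d (Suc h) 0 m M r"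
    proof (rule elim_boundI)
      fix n A B and Q :: "'p point \<Rightarrow> 'p mod_ring"
      assume "poly_fun n d Q" "determined n g m Q" "finite A" "card A \<le> 0"
        "finite B" "card B \<le> M" "\<forall>b\<in>B. poly_fun n (Suc h - 1) b"
        "\<And>x. agree (A \<union> B) x origin \<Longrightarrow> Q x = 0"
      then show "decomposable n g d r Q" by (intro elim_boundD[OF r, of n Q B "{}"]) auto
    qed
    then show "\<exists>r. elim_bound TYPE('p) g d (Suc h) 0 m M r" by blast
  qed
  show ?case
  proof (induction N)
    case 0
    show ?case by (rule base)
  next
    case (Suc N)
    show ?case
      by (rule eliminable_Suc[OF IH Suc.IH _ _ _ d]) (use \<open>Suc h \<le> g\<close> \<open>Suc h < CARD('p)\<close> in auto)
  qed
qed

text \<open>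
  The hypothesis \<open>determined\<close> is used at the origin for the first level set. At the other points it
  serves the cofactors that appear on the way, which are combinations of translates of \<open>Q\<close> and of
  the remainders left by earlier divisions.
\<close>

theorem determined_imp_decomposable:
  assumes "d < CARD('p::prime_card)"
  shows "\<exists>r. \<forall>n (Q :: 'p point \<Rightarrow> 'p mod_ring). poly_fun n d Q \<and> determined n g m Q \<longrightarrow> decomposable n g d r Q"
  using assms
proof (induction d arbitrary: m rule: less_induct)
  case (less d)
  show ?case
  proof (cases "d \<le> g")
    case True
    then show ?thesis using decomposable_single by blast
  next
    case False
    have IH: "\<exists>r. \<forall>n (Q :: 'p point \<Rightarrow> 'p mod_ring). poly_fun n d' Q \<and> determined n g m Q \<longrightarrow> decomposable n g d' r Q"
      if "d' < d" for d' m
      using less.IH[OF that] less.prems that by (meson less_trans)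
    have "eliminable TYPE('p) g d g m"
      by (rule eliminable_all[OF IH less.prems]) (use False less.prems in auto)
    then obtain r where r: "elim_bound TYPE('p) g d g m m 0 r"
      unfolding eliminable_def by blast
    have "decomposable n g d (r + 1) Q" if Q: "poly_fun n d Q" "determined n g m Q"
      for n and Q :: "'p point \<Rightarrow> 'p mod_ring"
    proof -
      obtain B where B: "finite B" "card B \<le> m" "\<forall>b\<in>B. poly_fun n g b"
        "\<And>x. agree B x origin \<Longrightarrow> Q x = Q origin"
        using determinedD[OF Q(2), of origin] by blast
      have "decomposable n g d r (\<lambda>x. Q x - Q origin)"
      proof (rule elim_boundD[OF r, of n _ B "{}"])
        show "poly_fun n d (\<lambda>x. Q x - Q origin)" by (intro poly_fun_diff Q poly_fun.const)
        show "determined n g m (\<lambda>x. Q x - Q origin)" by (rule determined_map[OF Q(2)])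
      qed (use B in auto)
      moreover have "decomposable n g d 1 (\<lambda>_. Q origin)"
        by (rule decomposable_mono[OF decomposable_single[OF poly_fun.const[of n 0]]]) auto
      ultimately have "decomposable n g d (r + 1) (\<lambda>x. Q x - Q origin + Q origin)"
        by (rule decomposable_add)
      then show ?thesis by simp
    qed
    then show ?thesis by blast
  qed
qed

section \<open>Lowering the degree of the factors\<close>

lemma card_factors:
  assumes "length Ts \<le> r" "\<And>T. T \<in> set Ts \<Longrightarrow> length T \<le> r"
  shows "card (fst ` (\<Union>T\<in>set Ts. set T)) \<le> r * r"
proof -
  have "card (fst ` (\<Union>T\<in>set Ts. set T)) \<le> card (\<Union>T\<in>set Ts. set T)"
    by (rule card_image_le) simp
  also have "\<dots> \<le> (\<Sum>T\<in>set Ts. card (set T))" by (rule card_UN_le) simp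
  also have "\<dots> \<le> (\<Sum>T\<in>set Ts. r)"
    by (intro sum_mono) (use assms(2) card_length order_trans in blast)
  also have "\<dots> \<le> r * r"
    using card_length[of Ts] assms(1) by simp
  finally show ?thesis .
qed

text \<open>
  Only factors of degree exactly \<open>g\<close> can have \<open>v a \<noteq> 0\<close>, and a product contains at most
  \<open>d div g \<le> t\<close> of them.
\<close>

lemma decomposable_along_affine_values:
  fixes Ts :: "(('p::prime_card point \<Rightarrow> 'p mod_ring) \<times> nat) list list"
  assumes "\<And>T. T \<in> set Ts \<Longrightarrow> sum_list (map snd T) \<le> d"
    "\<And>T a h. T \<in> set Ts \<Longrightarrow> (a, h) \<in> set T \<Longrightarrow> h < g \<Longrightarrow> v a = 0"
    "d < g * (t + 1)"
  shows "\<exists>A. degree A \<le> t \<and> (\<forall>y. poly A y = (\<Sum>T\<leftarrow>Ts. \<Prod>(a, h)\<leftarrow>T. a w + y * v a))"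
proof -
  define M where "M T = (\<Prod>(a, h)\<leftarrow>T. [:a w, v a:])" for T :: "(('p point \<Rightarrow> 'p mod_ring) \<times> nat) list"
  have poly_M: "poly (M T) y = (\<Prod>(a, h)\<leftarrow>T. a w + y * v a)" for T y
    unfolding M_def by (induction T) auto
  have deg: "g * degree (M T) \<le> sum_list (map snd T)"
    if "\<And>a h. (a, h) \<in> set T \<Longrightarrow> h < g \<Longrightarrow> v a = 0" for T
    using that
  proof (induction T)
    case Nil
    then show ?case by (simp add: M_def)
  next
    case (Cons q T)
    obtain a h where q: "q = (a, h)" by force
    have "M (q # T) = [:a w, v a:] * M T" by (simp add: M_def q)
    then have "degree (M (q # T)) \<le> degree [:a w, v a:] + degree (M T)"
      by (metis degree_mult_le)
    then have "g * degree (M (q # T)) \<le> g * degree [:a w, v a:] + g * degree (M T)"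
      by (metis add_mult_distrib2 mult_le_mono2)
    moreover have "g * degree [:a w, v a:] \<le> h"
      using Cons.prems[of a h] q by (cases "h < g") auto
    moreover have "g * degree (M T) \<le> sum_list (map snd T)"
      using Cons by auto
    ultimately show ?case by (simp add: q)
  qed
  have "degree (M T) \<le> t" if "T \<in> set Ts" for T
  proof -
    have "g * degree (M T) < g * (t + 1)"
      using deg[of T] assms(1)[OF that] assms(2)[OF that] assms(3) by (meson le_less_trans order_trans)
    then have "degree (M T) < t + 1" by (simp only: mult_less_cancel1)
    then show ?thesis by simp
  qed
  then have "degree (\<Sum>T\<leftarrow>Ts. M T) \<le> t"
    by (induction Ts) (auto intro: degree_add_le)
  moreover have "poly (\<Sum>T\<leftarrow>Ts. M T) y = (\<Sum>T\<leftarrow>Ts. \<Prod>(a, h)\<leftarrow>T. a w + y * v a)" for y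
    unfolding poly_M[symmetric] by (induction Ts) auto
  ultimately show ?thesis by blast
qed

definition avoids :: "nat \<Rightarrow> 'a::comm_ring_1 set \<Rightarrow> bool"
  where "avoids t S \<longleftrightarrow> (\<forall>A :: 'a poly. degree A > 0 \<and> degree A \<le> t \<longrightarrow> \<not> range (poly A) \<subseteq> S)"

text \<open>
  The number of polynomials counts, for each of the at most \<open>p\<close> to the power \<open>r * r\<close> increment vectors \<open>v\<close>
  of the at most \<open>r * r\<close> factors, the parts of degree less than \<open>g\<close> of all factors at two points: at
  \<open>w\<close>, and at a point where the steps with increments \<open>v\<close> get stuck.
\<close>

lemma avoids_imp_determined:
  fixes f :: "'p::prime_card point \<Rightarrow> 'p mod_ring"
  assumes decomposable: "decomposable n g d r f" and g: "1 \<le> g" "g < CARD('p)" "d < g * (t + 1)"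
    and avoid: "avoids t (range f)"
  shows "determined n (g - 1) (CARD('p) ^ (r * r) * (r * r * (2 * g))) f"
  unfolding determined_def
proof
  fix w
  let ?p = "CARD('p)"
  obtain Ts where Ts: "length Ts \<le> r"
    "\<And>T. T \<in> set Ts \<Longrightarrow> length T \<le> r \<and> sum_list (map snd T) \<le> d \<and> (\<forall>(a, h)\<in>set T. h \<le> g \<and> poly_fun n h a)"
    "\<And>x. f x = (\<Sum>T\<leftarrow>Ts. \<Prod>(a, h)\<leftarrow>T. a x)"
    using decomposable by (rule decomposableE) blast
  define F where "F = fst ` (\<Union>T\<in>set Ts. set T)"
  have F: "finite F" "card F \<le> r * r" "\<forall>a\<in>F. poly_fun n g a"
  proof -
    show "finite F" unfolding F_def by simp
    show "card F \<le> r * r" unfolding F_def using card_factors[OF Ts(1)] Ts(2) by blast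
    show "\<forall>a\<in>F. poly_fun n g a"
    proof
      fix a assume "a \<in> F"
      then obtain T h where "T \<in> set Ts" "(a, h) \<in> set T" unfolding F_def by auto
      then have "h \<le> g" "poly_fun n h a" using Ts(2)[of T] by auto
      then show "poly_fun n g a" by (metis poly_fun_mono)
    qed
  qed
  have in_F: "a \<in> F" if "T \<in> set Ts" "(a, h) \<in> set T" for a h T
    unfolding F_def using that by force
  define reach where "reach v i u \<longleftrightarrow> (\<forall>a\<in>F. a u = a w + of_nat i * v a)" for v i u
  define stuck where "stuck v u \<longleftrightarrow> (\<exists>i. reach v i u \<and> (\<forall>u'. \<not> reach v (Suc i) u'))" for v u
  \<comment> \<open>the value \<open>w\<close> is arbitrary: it is used for those \<open>v\<close> that never get stuck\<close>
  define U where "U v = (if \<exists>u. stuck v u then (SOME u. stuck v u) else w)" for v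
  define V where "V = F \<rightarrow>\<^sub>E (UNIV :: 'p mod_ring set)"
  have V: "finite V" "card V \<le> ?p ^ (r * r)"
  proof -
    show "finite V" unfolding V_def using F(1) by (intro finite_PiE) auto
    have "card V = ?p ^ card F" unfolding V_def using F(1) by (simp add: card_PiE)
    also have "\<dots> \<le> ?p ^ (r * r)" using F(2) prime_card_gt_1[where 'p='p] by (intro power_increasing) auto
    finally show "card V \<le> ?p ^ (r * r)" .
  qed
  define L where "L = (\<Union>v\<in>V. lower_parts g {w, U v} F)"
  have card2: "card {w, U v} \<le> 2" for v by (simp add: card_insert_if)
  have "card (lower_parts g {w, U v} F) \<le> r * r * (2 * g)" for v
  proof -
    have "card (lower_parts g {w, U v} F) \<le> card F * (card {w, U v} * g)"
      by (intro card_lower_parts(2) F(1)) simp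
    also have "\<dots> \<le> r * r * (2 * g)"
      by (intro mult_le_mono F(2) card2 order_refl)
    finally show ?thesis .
  qed
  then have "card L \<le> card V * (r * r * (2 * g))"
    unfolding L_def by (intro order_trans[OF card_UN_le[OF V(1)]] order_trans[OF sum_bounded_above]) auto
  also have "\<dots> \<le> ?p ^ (r * r) * (r * r * (2 * g))" by (intro mult_le_mono1 V(2))
  finally have card_L: "card L \<le> ?p ^ (r * r) * (r * r * (2 * g))" .
  have L: "finite L" "\<And>l. l \<in> L \<Longrightarrow> poly_fun n (g - 1) l"
    unfolding L_def using V(1) card_lower_parts(1)[OF F(1)] poly_fun_lower_parts[OF F(3) g(2)] by auto
  \<comment> \<open>the members of \<open>L\<close> are functions of the step, those of \<open>B\<close> of its end point\<close>
  define B where "B = (\<lambda>l x. l (shift x (- 1) w)) ` L"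
  have B: "finite B" "card B \<le> ?p ^ (r * r) * (r * r * (2 * g))"
    unfolding B_def using L(1) card_image_le[OF L(1)] card_L order_trans by blast+
  have B_poly_fun: "\<forall>b\<in>B. poly_fun n (g - 1) b"
  proof
    fix b assume "b \<in> B"
    then obtain l where "l \<in> L" "b = (\<lambda>x. l (shift x (- 1) w))" unfolding B_def by blast
    then show "poly_fun n (g - 1) b" using L(2) poly_fun_shift[of n "g - 1" l "- 1" w] by simp
  qed
  have "f x = f w" if x: "agree B x w" for x
  proof -
    define z where "z = shift x (- 1) w"
    have xz: "shift w 1 z = x" by (simp add: z_def shift_def)
    have "shift w (- 1) w = origin" by (simp add: shift_def)
    then have z: "agree L z origin"
      using x unfolding agree_def B_def z_def by auto
    define v where "v = (\<lambda>a\<in>F. a x - a w)"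
    have "v \<in> V" unfolding v_def V_def by auto
    then have zv: "agree (lower_parts g {w, U v} F) z origin"
      using z unfolding L_def agree_def by blast
    have step: "a (shift u 1 z) = a u + v a" if "a \<in> F" "u \<in> {w, U v}" for a u
      using additive_of_agree_lower_parts[of n g a F u "{w, U v}" w z 1] that F(3) g(1,2) zv
      by (simp add: v_def xz)
    have low: "v a = 0" if a: "T \<in> set Ts" "(a, h) \<in> set T" "h < g" for a h T
    proof -
      have "poly_fun n h a" "h < ?p" using Ts(2)[OF a(1)] a g(2) by auto
      moreover have "hom_part j a w z = 0" if "j \<in> {1..h}" for j
      proof -
        have "hom_part j a w \<in> lower_parts g {w, U v} F"
          using that a(3) in_F[OF a(1,2)] unfolding lower_parts_def
          by (intro UN_I[of a] UN_I[of w] imageI) auto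
        then have "hom_part j a w z = hom_part j a w origin" using zv unfolding agree_def by blast
        then show ?thesis using hom_part_zero_direction[of j a w] that a(3) g(2) by simp
      qed
      ultimately have "a (shift w 1 z) = a w"
        using poly_fun_expand[of n h a w 1 z] by simp
      then show ?thesis using in_F[OF a(1,2)] by (simp add: v_def xz)
    qed
    have "\<exists>u. reach v i u" for i
    proof (induction i)
      case 0
      show ?case by (intro exI[of _ w]) (simp add: reach_def)
    next
      case (Suc i)
      show ?case
      proof (rule ccontr)
        assume no: "\<nexists>u. reach v (Suc i) u"
        with Suc have "\<exists>u. stuck v u" unfolding stuck_def by blast
        then have "stuck v (U v)" unfolding U_def using someI_ex[of "stuck v"] by simp
        then obtain j where j: "reach v j (U v)" "\<And>u'. \<not> reach v (Suc j) u'"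
          unfolding stuck_def by blast
        have "reach v (Suc j) (shift (U v) 1 z)"
          unfolding reach_def
        proof
          fix a assume a: "a \<in> F"
          then have "a (U v) = a w + of_nat j * v a" using j(1) unfolding reach_def by blast
          then show "a (shift (U v) 1 z) = a w + of_nat (Suc j) * v a"
            using step[OF a, of "U v"] by (simp add: algebra_simps)
        qed
        then show False using j(2) by blast
      qed
    qed
    then obtain u where u: "\<And>i. reach v i (u i)" by metis
    obtain A where A: "degree A \<le> t" "\<And>y. poly A y = (\<Sum>T\<leftarrow>Ts. \<Prod>(a, h)\<leftarrow>T. a w + y * v a)"
      using decomposable_along_affine_values[of Ts d g v t w] Ts(2) low g(3) by blast
    have eval_A: "poly A y = f x'" if "\<forall>a\<in>F. a x' = a w + y * v a" for y x'
      unfolding A(2) Ts(3) using that in_F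
      by (intro arg_cong[where f=sum_list] map_cong refl arg_cong[where f=prod_list]) auto
    have "poly A y \<in> range f" for y
    proof -
      obtain i where "y = of_nat i" using surj_of_nat_mod_ring[of y] by blast
      then show ?thesis using eval_A[of "u i" y] u[of i] unfolding reach_def by simp
    qed
    then have "range (poly A) \<subseteq> range f" by (simp add: image_subset_iff)
    then have "\<not> degree A > 0"
      using avoid[unfolded avoids_def, THEN spec[of _ A]] A(1) by simp
    then have "degree A = 0" by simp
    then obtain c where "A = [:c:]" by (rule degree_eq_zeroE)
    moreover have "poly A 1 = f x" by (rule eval_A) (simp add: v_def)
    moreover have "poly A 0 = f w" by (rule eval_A) simp
    ultimately show ?thesis by simp
  qed
  then show "\<exists>B. finite B \<and> card B \<le> ?p ^ (r * r) * (r * r * (2 * g)) \<and>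
      (\<forall>b\<in>B. poly_fun n (g - 1) b) \<and> (\<forall>x. agree B x w \<longrightarrow> f x = f w)"
    using B B_poly_fun by blast
qed

text \<open>
  Downward induction from \<open>d\<close> to \<open>e\<close>; the hypothesis \<open>d < (e + 1) * (t + 1)\<close> is what
  \<open>avoids_imp_determined\<close> needs for every \<open>g > e\<close>.
\<close>

theorem avoids_imp_decomposable:
  assumes d: "d < CARD('p::prime_card)" "d' \<le> d" and e: "d < (e + 1) * (t + 1)" "e \<le> d"
  shows "\<exists>r. \<forall>n (f :: 'p point \<Rightarrow> 'p mod_ring). poly_fun n d' f \<and> avoids t (range f) \<longrightarrow> decomposable n e d' r f"
  using e(2)
proof (induction e rule: inc_induct)
  case base
  have "decomposable n d d' 1 f" if "poly_fun n d' f" for n and f :: "'p point \<Rightarrow> 'p mod_ring"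
    by (rule decomposable_single[OF that d(2)])
  then show ?case by blast
next
  case (step g)
  then obtain r where r: "\<And>n (f :: 'p point \<Rightarrow> 'p mod_ring). poly_fun n d' f \<Longrightarrow> avoids t (range f) \<Longrightarrow> decomposable n (Suc g) d' r f"
    by blast
  have "(e + 1) * (t + 1) \<le> Suc g * (t + 1)" using step by (intro mult_le_mono1) simp
  then have g: "1 \<le> Suc g" "Suc g < CARD('p)" "d' < Suc g * (t + 1)"
    using step d e(1) by linarith+
  obtain m where m: "\<And>n (f :: 'p point \<Rightarrow> 'p mod_ring). poly_fun n d' f \<Longrightarrow> avoids t (range f) \<Longrightarrow> determined n g m f"
    using avoids_imp_determined[OF r g] by auto
  have "d' < CARD('p)" using d by simp
  from determined_imp_decomposable[OF this, of g m] show ?case using m by blast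
qed

section \<open>Formal polynomials and polynomial functions\<close>

definition mono_eval :: "(nat \<Rightarrow>\<^sub>0 nat) \<Rightarrow> (nat \<Rightarrow> 'a::comm_semiring_1) \<Rightarrow> 'a"
  where "mono_eval m x = (\<Prod>i\<in>Poly_Mapping.keys m. x i ^ Poly_Mapping.lookup m i)"

lemma mono_eval_superset:
  assumes "finite A" "Poly_Mapping.keys m \<subseteq> A"
  shows "mono_eval m x = (\<Prod>i\<in>A. x i ^ Poly_Mapping.lookup m i)"
  unfolding mono_eval_def using assms
  by (intro prod.mono_neutral_left) (auto simp: in_keys_iff)

lemma mono_eval_add: "mono_eval (m + m') x = mono_eval m x * mono_eval m' x"
  using mono_eval_superset[of "Poly_Mapping.keys m \<union> Poly_Mapping.keys m'" "m + m'" x]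
    mono_eval_superset[of "Poly_Mapping.keys m \<union> Poly_Mapping.keys m'" m x]
    mono_eval_superset[of "Poly_Mapping.keys m \<union> Poly_Mapping.keys m'" m' x] Poly_Mapping.keys_add[of m m']
  by (simp add: lookup_add power_add prod.distrib)

lemma meval_superset:
  assumes "finite S" "Poly_Mapping.keys P \<subseteq> S"
  shows "meval P x = (\<Sum>m\<in>S. Poly_Mapping.lookup P m * mono_eval m x)"
  unfolding meval_def mono_eval_def using assms
  by (intro sum.mono_neutral_left) (auto simp: in_keys_iff)

lemma meval_add: "meval (P + Q) x = meval P x + meval Q x"
  using meval_superset[of "Poly_Mapping.keys P \<union> Poly_Mapping.keys Q" "P + Q" x]
    meval_superset[of "Poly_Mapping.keys P \<union> Poly_Mapping.keys Q" P x]
    meval_superset[of "Poly_Mapping.keys P \<union> Poly_Mapping.keys Q" Q x] Poly_Mapping.keys_add[of P Q]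
  by (simp add: lookup_add distrib_right sum.distrib)

lemma meval_zero [simp]: "meval 0 x = 0"
  by (simp add: meval_def)

lemma meval_sum: "meval (\<Sum>i\<in>I. P i) x = (\<Sum>i\<in>I. meval (P i) x)"
  by (induction I rule: infinite_finite_induct) (auto simp: meval_add)

lemma meval_single: "meval (Poly_Mapping.single m c) x = c * mono_eval m x"
  using meval_superset[of "{m}" "Poly_Mapping.single m c" x] by simp

lemma sum_of_terms:
  "P = (\<Sum>m\<in>Poly_Mapping.keys P. Poly_Mapping.single m (Poly_Mapping.lookup P m))"
  by (intro poly_mapping_eqI) (auto simp: lookup_sum lookup_single when_def in_keys_iff)

lemma meval_mult:
  fixes P Q :: "'a::comm_semiring_1 mpoly"
  shows "meval (P * Q) x = meval P x * meval Q x"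
proof -
  have "P * Q = (\<Sum>m\<in>Poly_Mapping.keys P. \<Sum>m'\<in>Poly_Mapping.keys Q.
      Poly_Mapping.single (m + m') (Poly_Mapping.lookup P m * Poly_Mapping.lookup Q m'))"
    by (subst sum_of_terms[of P], subst sum_of_terms[of Q]) (simp add: sum_product mult_single)
  then have "meval (P * Q) x = (\<Sum>m\<in>Poly_Mapping.keys P. \<Sum>m'\<in>Poly_Mapping.keys Q.
      (Poly_Mapping.lookup P m * mono_eval m x) * (Poly_Mapping.lookup Q m' * mono_eval m' x))"
    by (simp add: meval_sum meval_single mono_eval_add mult_ac)
  then show ?thesis by (simp add: sum_product meval_def mono_eval_def)
qed

lemma meval_one [simp]: "meval 1 x = 1"
  using meval_single[of 0 1 x] by (simp add: mono_eval_def)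

lemma meval_prod_list: "meval (prod_list Ps) x = (\<Prod>P\<leftarrow>Ps. meval P x)"
  by (induction Ps) (auto simp: meval_mult)

lemma meval_sum_list: "meval (sum_list Ps) x = (\<Sum>P\<leftarrow>Ps. meval P x)"
  by (induction Ps) (auto simp: meval_add)

lemma total_degree_le_iff:
  "total_degree P \<le> d \<longleftrightarrow> (\<forall>m\<in>Poly_Mapping.keys P. monom_degree m \<le> d)"
  unfolding total_degree_def by (subst Max_le_iff) auto

definition bounded_polys :: "nat \<Rightarrow> nat \<Rightarrow> 'a::zero mpoly set"
  where "bounded_polys n d = {P \<in> polys n. total_degree P \<le> d}"

lemma bounded_polys_iff:
  "P \<in> bounded_polys n d \<longleftrightarrow>
    (\<forall>m\<in>Poly_Mapping.keys P. Poly_Mapping.keys m \<subseteq> {..<n} \<and> monom_degree m \<le> d)"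
  unfolding bounded_polys_def polys_def total_degree_le_iff by auto

lemma bounded_polys_add: "P \<in> bounded_polys n d \<Longrightarrow> Q \<in> bounded_polys n d \<Longrightarrow> P + Q \<in> bounded_polys n d"
  unfolding bounded_polys_iff using Poly_Mapping.keys_add[of P Q] by blast

lemma bounded_polys_mult:
  assumes "P \<in> bounded_polys n d" "Q \<in> bounded_polys n e"
  shows "P * Q \<in> bounded_polys n (d + e)"
  unfolding bounded_polys_iff
proof
  fix k assume "k \<in> Poly_Mapping.keys (P * Q)"
  then obtain a b where ab: "k = a + b" "a \<in> Poly_Mapping.keys P" "b \<in> Poly_Mapping.keys Q"
    using keys_mult[of P Q] by blast
  then show "Poly_Mapping.keys k \<subseteq> {..<n} \<and> monom_degree k \<le> d + e"
    using assms Poly_Mapping.keys_add[of a b] unfolding bounded_polys_iff ab(1) monom_degree_add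
    by (meson Un_least add_mono order_trans)
qed

lemma poly_fun_iff_meval: "poly_fun n d f \<longleftrightarrow> (\<exists>P\<in>bounded_polys n d. f = meval P)"
proof
  assume "poly_fun n d f"
  then show "\<exists>P\<in>bounded_polys n d. f = meval P"
  proof induction
    case (const d c)
    show ?case
      by (intro bexI[of _ "Poly_Mapping.single 0 c"])
        (auto simp: meval_single mono_eval_def bounded_polys_iff monom_degree_def)
  next
    case (coord i d)
    then show ?case
      by (intro bexI[of _ "Poly_Mapping.single (Poly_Mapping.single i 1) 1"])
        (auto simp: meval_single mono_eval_def bounded_polys_iff monom_degree_def)
  next
    case (add d f g)
    then show ?case using bounded_polys_add meval_add by (metis (no_types, lifting) ext)
  next
    case (mult d f e g)
    then show ?case using bounded_polys_mult meval_mult by (metis (no_types, lifting) ext)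
  qed
next
  assume "\<exists>P\<in>bounded_polys n d. f = meval P"
  then obtain P where P: "P \<in> bounded_polys n d" "f = meval P" by blast
  have power: "poly_fun n k (\<lambda>x. x i ^ k)" if "i < n" for i k
    using poly_fun_power[OF poly_fun.coord[OF that, of 0], of k] by simp
  have prod: "poly_fun n (\<Sum>i\<in>I. k i) (\<lambda>x. \<Prod>i\<in>I. x i ^ k i)" if "I \<subseteq> {..<n}" for I k
    using finite_subset[OF that finite_lessThan] that
    by (induction I rule: finite_induct) (auto intro: poly_fun.intros power)
  have "poly_fun n d (mono_eval m)" if "m \<in> Poly_Mapping.keys P" for m
    using prod[of "Poly_Mapping.keys m" "Poly_Mapping.lookup m"] P(1) that poly_fun_mono
    unfolding bounded_polys_iff mono_eval_def[abs_def] monom_degree_def by blast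
  then have "poly_fun n d (\<lambda>x. \<Sum>m\<in>Poly_Mapping.keys P. Poly_Mapping.lookup P m * mono_eval m x)"
    by (intro poly_fun_sum poly_fun_cmult)
  then show "poly_fun n d f" unfolding P(2) meval_def[abs_def] mono_eval_def by simp
qed

text \<open>
  Weighted summation over all points extracts the coefficient of a monomial \<open>m\<close> of maximal degree: a
  monomial \<open>m'\<close> contributes only if all its exponents are at least those of \<open>m\<close>, hence only if \<open>m' = m\<close>.
\<close>

lemma meval_eq_zero_imp:
  fixes P :: "'p::prime_card mod_ring mpoly"
  assumes P: "P \<in> bounded_polys n d" "d < CARD('p)" and zero: "\<And>x. meval P x = 0"
  shows "P = 0"
proof (rule ccontr)
  assume "P \<noteq> 0"
  let ?p = "CARD('p)" and ?K = "Poly_Mapping.keys P"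
  obtain m where m: "m \<in> ?K" "\<And>m'. m' \<in> ?K \<Longrightarrow> monom_degree m' \<le> monom_degree m"
  proof -
    have "finite (monom_degree ` ?K)" "monom_degree ` ?K \<noteq> {}" using \<open>P \<noteq> 0\<close> by auto
    from Max_in[OF this] obtain m where "m \<in> ?K" "monom_degree m = Max (monom_degree ` ?K)" by auto
    then show ?thesis using that[of m] by simp
  qed
  have deg: "monom_degree m' = (\<Sum>i<n. Poly_Mapping.lookup m' i)" if "m' \<in> ?K" for m'
    using P(1) that monom_degree_superset[of "{..<n}" m'] by (auto simp: bounded_polys_iff)
  have exponent: "Poly_Mapping.lookup m' i \<le> ?p - 1" if "m' \<in> ?K" "i < n" for m' i
  proof -
    have "Poly_Mapping.lookup m' i \<le> (\<Sum>i<n. Poly_Mapping.lookup m' i)"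
      using that(2) by (intro member_le_sum) auto
    also have "\<dots> \<le> d" using P(1) that(1) deg[OF that(1)] by (auto simp: bounded_polys_iff)
    finally show ?thesis using P(2) by simp
  qed
  define J where "J m' = (\<Prod>i<n. \<Sum>c\<in>UNIV. (c :: 'p mod_ring) ^ (?p - 1 - Poly_Mapping.lookup m i) * c ^ Poly_Mapping.lookup m' i)" for m'
  have J_zero: "J m' = 0" if m': "m' \<in> ?K" "m' \<noteq> m" for m'
  proof -
    have "\<exists>i<n. Poly_Mapping.lookup m' i < Poly_Mapping.lookup m i"
    proof (rule ccontr)
      assume "\<not> ?thesis"
      then have ge: "Poly_Mapping.lookup m i \<le> Poly_Mapping.lookup m' i" if "i < n" for i
        using that by (meson not_less)
      have eq: "Poly_Mapping.lookup m i = Poly_Mapping.lookup m' i" if "i < n" for i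
      proof (rule ccontr)
        assume "Poly_Mapping.lookup m i \<noteq> Poly_Mapping.lookup m' i"
        then have "(\<Sum>i<n. Poly_Mapping.lookup m i) < (\<Sum>i<n. Poly_Mapping.lookup m' i)"
          using that ge by (intro sum_strict_mono_ex1) (auto simp: le_less intro!: bexI[of _ i])
        then show False using m(2)[OF m'(1)] deg m' m(1) by simp
      qed
      have "Poly_Mapping.lookup m i = Poly_Mapping.lookup m' i" for i
      proof (cases "i < n")
        case False
        then have "i \<notin> Poly_Mapping.keys m" "i \<notin> Poly_Mapping.keys m'"
          using P(1) m(1) m'(1) unfolding bounded_polys_iff by auto
        then show ?thesis by (simp add: in_keys_iff)
      qed (rule eq)
      then show False using m'(2) by (metis poly_mapping_eqI)
    qed
    then obtain i where i: "i < n" "Poly_Mapping.lookup m' i < Poly_Mapping.lookup m i" by blast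
    then have "(\<Sum>c\<in>UNIV. (c :: 'p mod_ring) ^ (?p - 1 - Poly_Mapping.lookup m i) * c ^ Poly_Mapping.lookup m' i) = 0"
      using exponent[OF m(1) i(1)] exponent[OF m'(1) i(1)] by (subst sum_power_shifted) auto
    then show ?thesis unfolding J_def using i(1) by (intro prod_zero) auto
  qed
  have "J m = (\<Prod>i<n. - 1)"
    unfolding J_def
  proof (rule prod.cong[OF refl])
    fix i assume "i \<in> {..<n}"
    then have "?p - 1 - Poly_Mapping.lookup m i + Poly_Mapping.lookup m i = ?p - 1"
      using exponent[OF m(1), of i] \<open>i \<in> {..<n}\<close> by simp
    then show "(\<Sum>c\<in>UNIV. (c :: 'p mod_ring) ^ (?p - 1 - Poly_Mapping.lookup m i) * c ^ Poly_Mapping.lookup m i) = - 1"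
      unfolding power_add[symmetric] by (simp only: sum_power_top)
  qed
  then have "J m \<noteq> 0" by simp
  let ?E = "{..<n} \<rightarrow>\<^sub>E (UNIV :: 'p mod_ring set)"
  let ?W = "\<lambda>x :: 'p point. \<Prod>i<n. x i ^ (?p - 1 - Poly_Mapping.lookup m i)"
  have J_sum: "J m' = (\<Sum>x\<in>?E. ?W x * mono_eval m' x)" if "m' \<in> ?K" for m'
  proof -
    have "mono_eval m' x = (\<Prod>i<n. x i ^ Poly_Mapping.lookup m' i)" for x :: "'p point"
      using P(1) that by (intro mono_eval_superset) (auto simp: bounded_polys_iff)
    then show ?thesis unfolding J_def by (subst prod_sum_PiE) (auto simp: prod.distrib)
  qed
  have "0 = (\<Sum>x\<in>?E. ?W x * meval P x)" using zero by simp
  also have "\<dots> = (\<Sum>m'\<in>?K. Poly_Mapping.lookup P m' * (\<Sum>x\<in>?E. ?W x * mono_eval m' x))"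
    unfolding meval_superset[OF finite_keys order_refl] sum_distrib_left
    by (subst sum.swap) (simp add: mult_ac)
  also have "\<dots> = (\<Sum>m'\<in>?K. Poly_Mapping.lookup P m' * J m')"
    by (intro sum.cong) (auto simp: J_sum)
  also have "\<dots> = (\<Sum>m'\<in>{m}. Poly_Mapping.lookup P m' * J m')"
    using m(1) J_zero by (intro sum.mono_neutral_right) auto
  finally show False using \<open>J m \<noteq> 0\<close> m(1) by (simp add: in_keys_iff)
qed

lemma meval_inject:
  fixes P Q :: "'p::prime_card mod_ring mpoly"
  assumes "P \<in> bounded_polys n d" "Q \<in> bounded_polys n d" "d < CARD('p)" "\<And>x. meval P x = meval Q x"
  shows "P = Q"
proof -
  have "- Q \<in> bounded_polys n d" using assms(2) by (simp add: bounded_polys_iff)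
  then have "P - Q \<in> bounded_polys n d"
    using bounded_polys_add[OF assms(1), of "- Q"] by simp
  moreover have "meval (P - Q) x = 0" for x
    using meval_add[of "P - Q" Q x] assms(4) by simp
  ultimately show ?thesis using meval_eq_zero_imp[OF _ assms(3)] by force
qed

lemma mimage_eq_range:
  assumes "P \<in> polys n"
  shows "mimage n P = range (meval P)"
proof -
  have "meval P x = meval P (restrict x {..<n})" for x
    unfolding meval_def using assms
    by (intro sum.cong arg_cong2[where f="(*)"] prod.cong refl) (auto simp: polys_def)
  moreover have "restrict x {..<n} \<in> {..<n} \<rightarrow>\<^sub>E UNIV" for x :: "nat \<Rightarrow> 'a" by simp
  ultimately show ?thesis unfolding mimage_def by blast
qed

section \<open>The degree rank\<close>

text \<open>
  Each factor is lifted to a formal polynomial. The two sides then agree as functions, and both have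
  degree less than \<open>p\<close>, so they agree formally.
\<close>

lemma decomposable_imp_has_decomposition:
  fixes P :: "'p::prime_card mod_ring mpoly"
  assumes P: "P \<in> polys n" "total_degree P < CARD('p)"
    and decomposable: "decomposable n e (total_degree P) r (meval P)"
  shows "\<exists>k\<le>r. has_decomposition n e P k"
proof -
  let ?d = "total_degree P"
  obtain Ts where Ts: "length Ts \<le> r"
    "\<And>T. T \<in> set Ts \<Longrightarrow> length T \<le> r \<and> sum_list (map snd T) \<le> ?d \<and> (\<forall>(a, h)\<in>set T. h \<le> e \<and> poly_fun n h a)"
    "\<And>x. meval P x = (\<Sum>T\<leftarrow>Ts. \<Prod>(a, h)\<leftarrow>T. a x)"
    using decomposable by (rule decomposableE) blast
  define M where "M q = (SOME R. R \<in> bounded_polys n (snd q) \<and> fst q = meval R)"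
    for q :: "('p point \<Rightarrow> 'p mod_ring) \<times> nat"
  have M: "M q \<in> bounded_polys n (snd q) \<and> fst q = meval (M q)" if "T \<in> set Ts" "q \<in> set T" for q T
  proof -
    have "poly_fun n (snd q) (fst q)" using Ts(2)[OF that(1)] that(2) by (cases q) auto
    then have "\<exists>R. R \<in> bounded_polys n (snd q) \<and> fst q = meval R"
      unfolding poly_fun_iff_meval by blast
    then show ?thesis unfolding M_def by (rule someI_ex)
  qed
  define R where "R T = prod_list (map M T)" for T
  have R_bounded: "R T \<in> bounded_polys n ?d" if T: "T \<in> set Ts" for T
  proof -
    have "set T' \<subseteq> set T \<Longrightarrow> prod_list (map M T') \<in> bounded_polys n (sum_list (map snd T'))" for T'
    proof (induction T')
      case Nil
      show ?case by (simp add: bounded_polys_iff monom_degree_def)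
    next
      case (Cons q T')
      then have "M q * prod_list (map M T') \<in> bounded_polys n (snd q + sum_list (map snd T'))"
        using M[OF T, of q] by (intro bounded_polys_mult) auto
      then show ?case by simp
    qed
    then have "R T \<in> bounded_polys n (sum_list (map snd T))" by (simp add: R_def)
    then show ?thesis using Ts(2)[OF T] by (auto simp: bounded_polys_def)
  qed
  have R_eval: "meval (R T) x = (\<Prod>(a, h)\<leftarrow>T. a x)" if "T \<in> set Ts" for T x
  proof -
    have "map (\<lambda>q. meval (M q) x) T = map (\<lambda>(a, h). a x) T"
      using M[OF that] by (intro map_cong) auto
    then show ?thesis by (simp only: R_def meval_prod_list map_map o_def)
  qed
  have "sum_list (map R Us) \<in> bounded_polys n ?d" if "set Us \<subseteq> set Ts" for Us
    using that
  proof (induction Us)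
    case Nil
    show ?case by (simp add: bounded_polys_iff)
  qed (auto intro: bounded_polys_add R_bounded)
  then have "sum_list (map R Ts) \<in> bounded_polys n ?d" by blast
  moreover have "meval P x = meval (sum_list (map R Ts)) x" for x
  proof -
    have "map (\<lambda>T. meval (R T) x) Ts = map (\<lambda>T. \<Prod>(a, h)\<leftarrow>T. a x) Ts"
      by (intro map_cong refl R_eval)
    then show ?thesis by (simp only: meval_sum_list map_map o_def Ts(3))
  qed
  ultimately have "P = sum_list (map R Ts)"
    using P by (intro meval_inject[of P n ?d]) (auto simp: bounded_polys_def)
  moreover have "rank_at_most_one n e (R T) \<and> total_degree (R T) \<le> ?d" if "T \<in> set Ts" for T
  proof
    show "rank_at_most_one n e (R T)"
      unfolding rank_at_most_one_def R_def
      using M[OF that] Ts(2)[OF that]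
      by (intro exI[of _ "map M T"]) (fastforce simp: bounded_polys_def)
    show "total_degree (R T) \<le> ?d" using R_bounded[OF that] by (simp add: bounded_polys_def)
  qed
  ultimately have "has_decomposition n e P (length Ts)"
    unfolding has_decomposition_def by (intro exI[of _ "map R Ts"]) auto
  then show ?thesis using Ts(1) by blast
qed

lemma decomposable_0_constant:
  assumes "decomposable n 0 d r f"
  shows "f x = f y"
proof -
  obtain Ts where Ts:
    "\<And>T. T \<in> set Ts \<Longrightarrow> length T \<le> r \<and> sum_list (map snd T) \<le> d \<and> (\<forall>(a, h)\<in>set T. h \<le> 0 \<and> poly_fun n h a)"
    "\<And>x. f x = (\<Sum>T\<leftarrow>Ts. \<Prod>(a, h)\<leftarrow>T. a x)"
    using assms by (rule decomposableE) blast
  have "a x = a y" if "T \<in> set Ts" "(a, h) \<in> set T" for T a h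
    using Ts(1)[OF that(1)] that(2) by (intro poly_fun_degree_0[of n a]) auto
  then show ?thesis
    unfolding Ts(2) by (intro arg_cong[where f=sum_list] map_cong refl arg_cong[where f=prod_list]) auto
qed

text \<open>
  The reduction is run with the degree \<open>d'\<close> of \<open>P\<close> in place of \<open>d\<close>, since the products in a
  decomposition must not exceed it; the sum over \<open>d' \<le> d\<close> makes the bound uniform. For \<open>t = d\<close> the
  factors have degree \<open>0\<close>, so \<open>P\<close> is constant.
\<close>

theorem theorem1p3:
  fixes d t :: nat
  assumes "1 \<le> t" and "t \<le> d" and "d < CARD('p::prime_card)"
  shows "\<exists>\<gamma>::nat. \<gamma> > 0 \<and>
    (\<forall>n::nat. n > 0 \<longrightarrow>
      (\<forall>P :: 'p mod_ring mpoly.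
        P \<in> polys n \<and> total_degree P \<le> d \<and>
        (\<forall>A :: 'p mod_ring poly.
          degree A > 0 \<and> degree A \<le> t \<longrightarrow> \<not> range (poly A) \<subseteq> mimage n P) \<longrightarrow>
        (t \<le> d - 1 \<longrightarrow> deg_rank n (d div (t + 1)) P \<le> \<gamma>) \<and>
        (t = d \<longrightarrow> (\<exists>c. P = mconst c))))"
proof -
  define e where "e = d div (t + 1)"
  have "d < (e + 1) * (t + 1)"
    unfolding e_def using dividend_less_div_times[of "t + 1" d] by (simp add: algebra_simps)
  moreover have "e \<le> d" by (simp add: e_def)
  ultimately have "\<exists>r. \<forall>n (f :: 'p point \<Rightarrow> 'p mod_ring). poly_fun n d' f \<and> avoids t (range f) \<longrightarrow> decomposable n e d' r f"
    if "d' \<le> d" for d'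
    using avoids_imp_decomposable[OF assms(3) that] by blast
  then obtain r where r: "\<And>d' n (f :: 'p point \<Rightarrow> 'p mod_ring). d' \<le> d \<Longrightarrow> poly_fun n d' f \<Longrightarrow>
      avoids t (range f) \<Longrightarrow> decomposable n e d' (r d') f"
    by metis
  define \<gamma> where "\<gamma> = Suc (\<Sum>d'\<le>d. r d')"
  have "(t \<le> d - 1 \<longrightarrow> deg_rank n e P \<le> \<gamma>) \<and> (t = d \<longrightarrow> (\<exists>c. P = mconst c))"
    if P: "P \<in> polys n" "total_degree P \<le> d" and
      avoid: "\<And>A :: 'p mod_ring poly. degree A > 0 \<and> degree A \<le> t \<Longrightarrow> \<not> range (poly A) \<subseteq> mimage n P"
    for n and P :: "'p mod_ring mpoly"
  proof -
    let ?d = "total_degree P"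
    have "avoids t (range (meval P))"
      using avoid mimage_eq_range[OF P(1)] unfolding avoids_def by blast
    moreover have "poly_fun n ?d (meval P)"
      unfolding poly_fun_iff_meval using P(1) by (auto simp: bounded_polys_def)
    ultimately have decomposable: "decomposable n e ?d (r ?d) (meval P)"
      using r P(2) by blast
    have small: "?d < CARD('p)" using P(2) assms(3) by simp
    obtain k where k: "k \<le> r ?d" "has_decomposition n e P k"
      using decomposable_imp_has_decomposition[OF P(1) small decomposable] by blast
    have "deg_rank n e P \<le> k" unfolding deg_rank_def by (rule Least_le) (rule k(2))
    also have "k \<le> \<gamma>"
      unfolding \<gamma>_def using k(1) P(2) member_le_sum[of ?d "{..d}" r] by simp
    finally have "deg_rank n e P \<le> \<gamma>" .
    moreover have "\<exists>c. P = mconst c" if "t = d"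
    proof -
      have "e = 0" using that by (simp add: e_def)
      then have "meval P x = meval (mconst (meval P origin)) x" for x
        using decomposable_0_constant[of n ?d "r ?d" "meval P" x origin] decomposable
        by (simp add: mconst_def meval_single mono_eval_def)
      moreover have "P \<in> bounded_polys n ?d" using P(1) by (simp add: bounded_polys_def)
      moreover have "mconst (meval P origin) \<in> bounded_polys n ?d"
        by (simp add: bounded_polys_iff mconst_def monom_degree_def)
      ultimately have "P = mconst (meval P origin)"
        using small meval_inject by blast
      then show ?thesis by blast
    qed
    ultimately show ?thesis by blast
  qed
  moreover have "\<gamma> > 0" by (simp add: \<gamma>_def)
  ultimately show ?thesis unfolding e_def by blast
qed

end
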